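(* Let $q$ be a prime with $q\equiv1\pmod4$, and write $q=a^2+b^2$ with $a,b\in\mathbb Z$, $a$ odd. Let $p$ be an odd prime with $p\nmid bq$. Then $$(-1)^{\frac{p^2-1}8+\frac{p-1}2\cdot\frac{q-1}4}\sum_{k=0}^{[p/4]}\binom{4k}{2k}\Big(\frac{a^2}{16q}\Big)^k\equiv\begin{cases}\pm1\pmod p&\text{if }p^{\frac{q-1}4}\equiv\pm1\pmod q,\\ \mp\frac ab\pmod p&\text{if }p^{\frac{q-1}4}\equiv\pm\frac ab\pmod q.\end{cases}$$
   Context: $[x]$ is the greatest integer $\le x$. Since $q\nmid b$, $\frac ab$ denotes a residue modulo $q$ (a square root of $-1$ mod $q$), and modulo $p$ it is the rational $a/b$. *)

theory Defs
  imports "HOL-Number_Theory.Number_Theory"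
begin

definition rat_cong :: "rat \<Rightarrow> rat \<Rightarrow> int \<Rightarrow> bool" where
  "rat_cong x y m \<longleftrightarrow> (\<exists>r. x - y = of_int m * r \<and> coprime (snd (quotient_of r)) m)"

end

(* Put n = (p - 1) / 2 and let chi be the quartic character modulo q that corresponds to the
   Gaussian prime a + b i, so that i corresponds to -a/b modulo q.  Let g, h, c be the Gauss sums of
   chi, chi^3, chi^2.  Then g^2 = J c and h^2 = cnj J c with J = +-(a + b i), c^2 = q and
   g h = chi(-1) q, so (g + h)^2 and (g - h)^2 are, up to sign, 2 c (c + a) and 2 c (c - a).
   Modulo p, (4k choose 2k) is 16^k (n choose 2k), which turns the sum into
   ((c + a)^n + (c - a)^n) / (2 c^n), that is, into a combination of (g + h)^(p-1) and (g - h)^(p-1).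
   The Frobenius congruence in the cyclotomic integers expresses g^p and h^p through g, h and chi(p),
   and chi(p) corresponds to p^((q-1)/4) modulo q.  The signs of a and J cancel. *)
theory Submission
  imports Defs "Jordan_Normal_Form.Char_Poly"
begin

section \<open>Cyclotomic integers and congruences modulo a prime\<close>

text \<open>The Frobenius congruence controls p-th powers, whereas the sum needs the exponent p - 1.
  Inverting g + h and g - h modulo p is avoided: each p-th power is multiplied by the opposite
  factor, which brings out (g + h) (g - h) = g^2 - h^2 = 2 b s i c, where J = s (a + b i) and s^2 =
  1. A further factor s c turns this into an integer multiple of i, and then 2, b and q can be
  cancelled, since p divides none of them. The way back from cyclotomic to rational congruences is
  that a rational algebraic integer is an integer. The sign in front of the sum is 2^n chi(-1)^n
  modulo p; it stems from the factor 2 chi(-1) c of (g + h)^2 and, up to -1, of (g - h)^2. Clearing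
  denominators costs a factor q^n, which is chi(p)^2 modulo p. The reversed sign in the case of a/b
  is a product of three: i corresponds to -a/b, the case chi(p) = i yields -a/b for the cleared sum,
  and there q^n is -1.\<close>

definition unity_root :: "nat \<Rightarrow> complex" where
  "unity_root N = cis (2 * pi / of_nat N)"

text \<open>The ring Z[zeta_N]. All N powers are used although they need not be linearly
  independent: coefficients are then not unique, but multiplication by the root is a mere cyclic
  shift of them.\<close>

definition cyclo_ints :: "nat \<Rightarrow> complex set" where
  "cyclo_ints N = {x. \<exists>a::nat \<Rightarrow> int. x = (\<Sum>k<N. of_int (a k) * unity_root N ^ k)}"

lemma unity_root_power_eq_1: "N > 0 \<Longrightarrow> unity_root N ^ N = 1"
  by (simp add: unity_root_def DeMoivre)

context
  fixes N :: nat
  assumes N: "N > 0"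
begin

lemma cyclo_ints_0 [simp]: "0 \<in> cyclo_ints N"
  unfolding cyclo_ints_def by (auto intro!: exI[of _ "\<lambda>_. 0"])

lemma cyclo_ints_add [intro]:
  assumes "x \<in> cyclo_ints N" "y \<in> cyclo_ints N"
  shows "x + y \<in> cyclo_ints N"
proof -
  from assms obtain a b where "x = (\<Sum>k<N. of_int (a k) * unity_root N ^ k)"
    "y = (\<Sum>k<N. of_int (b k) * unity_root N ^ k)" unfolding cyclo_ints_def by auto
  hence "x + y = (\<Sum>k<N. of_int (a k + b k) * unity_root N ^ k)"
    by (simp add: sum.distrib algebra_simps)
  thus ?thesis unfolding cyclo_ints_def by (auto intro!: exI[of _ "\<lambda>k. a k + b k"])
qed

lemma cyclo_ints_of_int_mult:
  assumes "x \<in> cyclo_ints N"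
  shows "of_int m * x \<in> cyclo_ints N"
proof -
  from assms obtain a where "x = (\<Sum>k<N. of_int (a k) * unity_root N ^ k)"
    unfolding cyclo_ints_def by auto
  hence "of_int m * x = (\<Sum>k<N. of_int (m * a k) * unity_root N ^ k)"
    by (simp add: sum_distrib_left algebra_simps)
  thus ?thesis unfolding cyclo_ints_def by (auto intro!: exI[of _ "\<lambda>k. m * a k"])
qed

lemma cyclo_ints_uminus [intro]: "x \<in> cyclo_ints N \<Longrightarrow> - x \<in> cyclo_ints N"
  using cyclo_ints_of_int_mult[of x "-1"] by simp

lemma cyclo_ints_diff [intro]: "x \<in> cyclo_ints N \<Longrightarrow> y \<in> cyclo_ints N \<Longrightarrow> x - y \<in> cyclo_ints N"
  using cyclo_ints_add[of x "- y"] by auto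

lemma cyclo_ints_sum [intro]: "(\<And>i. i \<in> I \<Longrightarrow> f i \<in> cyclo_ints N) \<Longrightarrow> sum f I \<in> cyclo_ints N"
  by (induction I rule: infinite_finite_induct) auto

lemma cyclo_ints_root_mult:
  assumes "x \<in> cyclo_ints N"
  shows "unity_root N ^ j * x \<in> cyclo_ints N"
proof (induction j)
  case (Suc j)
  then obtain a where a: "unity_root N ^ j * x = (\<Sum>k<N. of_int (a k) * unity_root N ^ k)"
    unfolding cyclo_ints_def by auto
  obtain M where M: "N = Suc M" using N by (cases N) auto
  \<comment> \<open>The cyclic shift: the last coefficient wraps around to position 0 because the
    N-th power of the root is 1.\<close>
  define b where "b k = (case k of 0 \<Rightarrow> a M | Suc k \<Rightarrow> a k)" for k
  have "(\<Sum>k<N. of_int (b k) * unity_root N ^ k) =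
      of_int (a M) * unity_root N ^ N + (\<Sum>k<M. of_int (a k) * unity_root N ^ Suc k)"
    by (subst M, subst sum.lessThan_Suc_shift) (simp add: b_def unity_root_power_eq_1 N)
  also have "\<dots> = (\<Sum>k<N. of_int (a k) * unity_root N ^ Suc k)"
    by (simp add: M)
  also have "\<dots> = unity_root N * (\<Sum>k<N. of_int (a k) * unity_root N ^ k)"
    by (simp add: sum_distrib_left mult_ac)
  also have "\<dots> = unity_root N ^ Suc j * x"
    by (simp add: a[symmetric])
  finally show ?case unfolding cyclo_ints_def by (auto intro!: exI[of _ b])
qed (use assms in auto)

lemma cyclo_ints_mult [intro]:
  assumes "x \<in> cyclo_ints N" "y \<in> cyclo_ints N"
  shows "x * y \<in> cyclo_ints N"
proof -
  from assms obtain a where "x = (\<Sum>k<N. of_int (a k) * unity_root N ^ k)"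
    unfolding cyclo_ints_def by auto
  hence "x * y = (\<Sum>k<N. of_int (a k) * (unity_root N ^ k * y))"
    by (simp add: sum_distrib_right mult.assoc)
  also have "\<dots> \<in> cyclo_ints N"
    by (intro cyclo_ints_sum cyclo_ints_of_int_mult cyclo_ints_root_mult assms)
  finally show ?thesis .
qed

lemma cyclo_ints_1 [simp]: "1 \<in> cyclo_ints N"
proof -
  have "(\<Sum>k<N. of_int (if k = 0 then 1 else 0) * unity_root N ^ k) = (\<Sum>k<N. if k = 0 then 1 else 0)"
    by (intro sum.cong) auto
  also have "\<dots> = 1" using N by (simp add: sum.delta)
  finally show ?thesis unfolding cyclo_ints_def
    by (auto intro!: exI[of _ "\<lambda>k. if k = 0 then 1 else 0"])
qed

lemma cyclo_ints_power [intro]: "x \<in> cyclo_ints N \<Longrightarrow> x ^ k \<in> cyclo_ints N"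
  by (induction k) auto

lemma cyclo_ints_of_int [simp]: "of_int m \<in> cyclo_ints N"
  using cyclo_ints_of_int_mult[OF cyclo_ints_1, of m] by simp

lemma cyclo_ints_of_nat [simp]: "of_nat m \<in> cyclo_ints N"
  using cyclo_ints_of_int[of "int m"] by simp

lemma cyclo_ints_root [simp]: "unity_root N \<in> cyclo_ints N"
  using cyclo_ints_root_mult[OF cyclo_ints_1, of 1] by simp

lemma cyclo_ints_cis:
  assumes "d dvd N"
  shows "cis (2 * pi * of_int k / of_nat d) \<in> cyclo_ints N"
proof -
  from assms obtain j where j: "N = d * j" by auto
  \<comment> \<open>Reducing modulo d gives a natural exponent, so that negative k are covered
    too.\<close>
  define k' where "k' = nat (k mod int d)"
  have d: "d > 0" and j0: "j > 0" using N j by auto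
  have k: "k = int k' + int d * (k div int d)" using d by (simp add: k'_def)
  have "cis (2 * pi * of_int k / of_nat d) = cis (2 * pi * of_nat k' / of_nat d + 2 * pi * of_int (k div int d))"
    by (subst k) (use d in \<open>simp add: field_simps\<close>)
  also have "\<dots> = cis (2 * pi * of_nat k' / of_nat d)"
    by (simp add: cis_multiple_2pi flip: cis_mult)
  also have "\<dots> = unity_root N ^ (j * k')"
    unfolding unity_root_def DeMoivre using d j0 by (simp add: j field_simps)
  finally show ?thesis by (simp add: cyclo_ints_power)
qed

text \<open>Multiplication by \<open>x\<close> acts on the powers of the root of unity through an integer matrix,
  and \<open>x\<close> is an eigenvalue of it.\<close>
lemma cyclo_ints_algebraic_int:
  assumes x: "x \<in> cyclo_ints N"
  shows "algebraic_int x"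
proof -
  let ?w = "unity_root N"
  have "\<exists>a::nat \<Rightarrow> int. ?w ^ j * x = (\<Sum>k<N. of_int (a k) * ?w ^ k)" for j
    using cyclo_ints_root_mult[OF x, of j] unfolding cyclo_ints_def by auto
  then obtain a :: "nat \<Rightarrow> nat \<Rightarrow> int" where
    a: "?w ^ j * x = (\<Sum>k<N. of_int (a j k) * ?w ^ k)" for j by metis
  define A where "A = mat N N (\<lambda>(j, k). a j k)"
  define v where "v = vec N (\<lambda>k. ?w ^ k)"
  have A: "A \<in> carrier_mat N N" by (simp add: A_def)
  let ?B = "map_mat of_int A :: complex mat"
  have B: "?B \<in> carrier_mat N N" by (simp add: A_def)
  have "eigenvector ?B v x"
    unfolding eigenvector_def
  proof (intro conjI)
    show "v \<in> carrier_vec (dim_row ?B)" by (simp add: v_def A_def)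
    show "v \<noteq> 0\<^sub>v (dim_row ?B)"
    proof
      assume "v = 0\<^sub>v (dim_row ?B)"
      hence "v $ 0 = 0" using N by (simp add: A_def)
      thus False using N by (simp add: v_def)
    qed
    show "?B *\<^sub>v v = x \<cdot>\<^sub>v v"
    proof (rule eq_vecI)
      fix j assume "j < dim_vec (x \<cdot>\<^sub>v v)"
      hence j: "j < N" by (simp add: v_def)
      have "(?B *\<^sub>v v) $ j = (\<Sum>k<N. of_int (a j k) * ?w ^ k)"
        using j by (simp add: A_def v_def scalar_prod_def atLeast0LessThan)
      also have "\<dots> = (x \<cdot>\<^sub>v v) $ j" using j by (simp add: v_def flip: a)
      finally show "(?B *\<^sub>v v) $ j = (x \<cdot>\<^sub>v v) $ j" .
    qed (simp add: A_def v_def)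
  qed
  hence "poly (char_poly ?B) x = 0"
    using eigenvalue_root_char_poly[OF B] by (auto simp: eigenvalue_def)
  moreover have "char_poly ?B = map_poly of_int (char_poly A)"
    by (rule of_int_hom.char_poly_hom[OF A])
  moreover have "lead_coeff (char_poly A) = 1"
    using degree_monic_char_poly[OF A] by simp
  ultimately show ?thesis
    unfolding algebraic_int_altdef_ipoly by (intro exI[of _ "char_poly A"]) auto
qed

section \<open>Congruence modulo p in the cyclotomic ring, and the Frobenius map\<close>

definition cyclo_cong :: "nat \<Rightarrow> complex \<Rightarrow> complex \<Rightarrow> bool" where
  "cyclo_cong p x y \<longleftrightarrow> (\<exists>z\<in>cyclo_ints N. x - y = of_nat p * z)"

lemma cyclo_cong_refl [simp, intro]: "cyclo_cong p x x"
  unfolding cyclo_cong_def by (auto intro!: bexI[of _ 0])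

lemma cyclo_cong_sym: "cyclo_cong p x y \<Longrightarrow> cyclo_cong p y x"
  unfolding cyclo_cong_def by (metis cyclo_ints_uminus minus_diff_eq mult_minus_right)

lemma cyclo_cong_add:
  assumes "cyclo_cong p x y" "cyclo_cong p x' y'"
  shows "cyclo_cong p (x + x') (y + y')"
proof -
  from assms obtain z z' where "z \<in> cyclo_ints N" "z' \<in> cyclo_ints N"
    "x - y = of_nat p * z" "x' - y' = of_nat p * z'" unfolding cyclo_cong_def by auto
  thus ?thesis unfolding cyclo_cong_def
    by (intro bexI[of _ "z + z'"]) (auto simp: algebra_simps)
qed

lemma cyclo_cong_trans [trans]:
  "cyclo_cong p x y \<Longrightarrow> cyclo_cong p y z \<Longrightarrow> cyclo_cong p x z"
proof -
  assume "cyclo_cong p x y" "cyclo_cong p y z"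
  hence "cyclo_cong p (x + y) (y + z)" by (rule cyclo_cong_add)
  thus ?thesis by (simp add: cyclo_cong_def)
qed

lemma cyclo_cong_mult_right:
  assumes "cyclo_cong p x y" "u \<in> cyclo_ints N"
  shows "cyclo_cong p (x * u) (y * u)"
proof -
  from assms obtain z where "z \<in> cyclo_ints N" "x - y = of_nat p * z"
    unfolding cyclo_cong_def by auto
  thus ?thesis unfolding cyclo_cong_def using assms(2)
    by (intro bexI[of _ "z * u"]) (auto simp: mult.assoc simp flip: left_diff_distrib)
qed

lemma cyclo_cong_mult_left:
  "cyclo_cong p x y \<Longrightarrow> u \<in> cyclo_ints N \<Longrightarrow> cyclo_cong p (u * x) (u * y)"
  using cyclo_cong_mult_right[of p x y u] by (simp add: mult.commute)

lemma cyclo_cong_uminus: "cyclo_cong p x y \<Longrightarrow> cyclo_cong p (- x) (- y)"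
  using cyclo_cong_mult_left[of p x y "-1"] cyclo_ints_of_int[of "-1"] by simp

lemma cyclo_cong_diff:
  "cyclo_cong p x y \<Longrightarrow> cyclo_cong p x' y' \<Longrightarrow> cyclo_cong p (x - x') (y - y')"
  using cyclo_cong_add[of p x y "- x'" "- y'"] cyclo_cong_uminus by simp

lemma cyclo_cong_of_intI:
  assumes "[x = y] (mod int p)"
  shows "cyclo_cong p (of_int x) (of_int y)"
proof -
  from assms obtain k where "x - y = int p * k" unfolding cong_iff_dvd_diff by auto
  hence "(of_int x - of_int y :: complex) = of_nat p * of_int k"
    by (metis of_int_diff of_int_mult of_int_of_nat_eq)
  thus ?thesis unfolding cyclo_cong_def by (intro bexI[of _ "of_int k"]) auto
qed

text \<open>The quotient by p is rational and an algebraic integer, hence an integer. This is the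
  only way back to integer congruences and the purpose of
  \<open>cyclo_ints_algebraic_int\<close>.\<close>

lemma cyclo_cong_of_intD:
  assumes "cyclo_cong p (of_int x) (of_int y)" "p > 0"
  shows "[x = y] (mod int p)"
proof -
  from assms obtain z where z: "z \<in> cyclo_ints N" "of_int x - of_int y = of_nat p * z"
    unfolding cyclo_cong_def by auto
  have eq: "z = of_int (x - y) / of_int (int p)" using z(2) assms(2) by (simp add: field_simps)
  have "z \<in> \<rat>" unfolding eq by (intro Rats_divide) auto
  hence "z \<in> \<int>" using rational_algebraic_int_is_int[OF cyclo_ints_algebraic_int[OF z(1)]] by auto
  then obtain k where "z = of_int k" by (auto elim: Ints_cases)
  with z(2) have "(of_int (x - y) :: complex) = of_int (int p * k)" by simp
  hence "x - y = int p * k" by (simp only: of_int_eq_iff)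
  thus ?thesis by (auto simp: cong_iff_dvd_diff)
qed

text \<open>An inverse \<open>m'\<close> of \<open>m\<close> modulo p undoes the factor:
  \<open>m' * m * u\<close> and \<open>u\<close> differ by a multiple of p times \<open>u\<close>,
  which is why \<open>x\<close> and \<open>y\<close> have to lie in the ring.\<close>

lemma cyclo_cong_cancel:
  assumes "cyclo_cong p (of_int m * x) (of_int m * y)" "coprime m (int p)"
    "x \<in> cyclo_ints N" "y \<in> cyclo_ints N"
  shows "cyclo_cong p x y"
proof -
  obtain m' where m': "[m * m' = 1] (mod int p)" using assms(2) cong_solve_coprime_int by blast
  have *: "cyclo_cong p (of_int m' * (of_int m * u)) u" if "u \<in> cyclo_ints N" for u
    using cyclo_cong_mult_right[OF cyclo_cong_of_intI[OF m'] that] by (simp add: mult_ac)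
  have "cyclo_cong p (of_int m' * (of_int m * x)) (of_int m' * (of_int m * y))"
    by (intro cyclo_cong_mult_left assms(1)) auto
  thus ?thesis using *[OF assms(3)] *[OF assms(4)] cyclo_cong_sym cyclo_cong_trans by blast
qed

lemma cyclo_cong_frobenius:
  assumes p: "prime p" and xy: "x \<in> cyclo_ints N" "y \<in> cyclo_ints N"
  shows "cyclo_cong p ((x + y) ^ p) (x ^ p + y ^ p)"
proof -
  have p0: "p > 0" using p prime_gt_0_nat by blast
  have "\<exists>c. p choose k = p * c" if "k \<in> {1..<p}" for k
    using dvd_choose_prime[of k p] that p by (auto elim!: dvdE)
  then obtain c where c: "\<And>k. k \<in> {1..<p} \<Longrightarrow> p choose k = p * c k" by metis
  have "(x + y) ^ p = (\<Sum>k\<le>p. of_nat (p choose k) * x ^ k * y ^ (p - k))"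
    by (rule binomial_ring)
  also have "{..p} = insert 0 (insert p {1..<p})" using p0 by auto
  also have "(\<Sum>k\<in>\<dots>. of_nat (p choose k) * x ^ k * y ^ (p - k)) =
      y ^ p + (x ^ p + (\<Sum>k=1..<p. of_nat (p choose k) * x ^ k * y ^ (p - k)))"
    using p0 by simp
  also have "(\<Sum>k=1..<p. of_nat (p choose k) * x ^ k * y ^ (p - k)) =
      of_nat p * (\<Sum>k=1..<p. of_nat (c k) * x ^ k * y ^ (p - k))"
    by (subst sum_distrib_left, rule sum.cong) (auto simp: c mult_ac)
  finally have "(x + y) ^ p - (x ^ p + y ^ p) =
      of_nat p * (\<Sum>k=1..<p. of_nat (c k) * x ^ k * y ^ (p - k))" by simp
  moreover have "(\<Sum>k=1..<p. of_nat (c k) * x ^ k * y ^ (p - k)) \<in> cyclo_ints N"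
    using xy by (intro cyclo_ints_sum cyclo_ints_mult cyclo_ints_power) auto
  ultimately show ?thesis unfolding cyclo_cong_def by blast
qed

lemma cyclo_cong_frobenius_sum:
  assumes p: "prime p" and f: "\<And>i. i \<in> I \<Longrightarrow> f i \<in> cyclo_ints N"
  shows "cyclo_cong p ((\<Sum>i\<in>I. f i) ^ p) (\<Sum>i\<in>I. f i ^ p)"
  using f
proof (induction I rule: infinite_finite_induct)
  case (insert i I)
  have "cyclo_cong p ((f i + sum f I) ^ p) (f i ^ p + sum f I ^ p)"
    using insert.prems by (intro cyclo_cong_frobenius[OF p] cyclo_ints_sum) auto
  also have "cyclo_cong p \<dots> (f i ^ p + (\<Sum>i\<in>I. f i ^ p))"
    using insert by (intro cyclo_cong_add) auto
  finally show ?case using insert by simp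
qed (use prime_gt_0_nat[OF p] in \<open>simp_all add: power_0_left\<close>)

end

section \<open>Gauss and Jacobi sums\<close>

lemma residues_affine_bij:
  fixes c d :: int and q :: nat
  assumes "q > 0" "coprime c (int q)"
  shows "bij_betw (\<lambda>x. (c * x + d) mod int q) {0..<int q} {0..<int q}"
proof -
  have "inj_on (\<lambda>x. (c * x + d) mod int q) {0..<int q}"
  proof
    fix x y assume xy: "x \<in> {0..<int q}" "y \<in> {0..<int q}"
      "(c * x + d) mod int q = (c * y + d) mod int q"
    hence "[c * x + d = c * y + d] (mod int q)" by (simp add: cong_def)
    hence "[c * x = c * y] (mod int q)" by (simp add: cong_add_rcancel)
    hence "[x = y] (mod int q)" using assms(2) cong_mult_lcancel[of c "int q"] by blast
    thus "x = y" using xy by (simp add: cong_def)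
  qed
  moreover have "(\<lambda>x. (c * x + d) mod int q) ` {0..<int q} \<subseteq> {0..<int q}" using assms(1) by auto
  ultimately show ?thesis by (simp add: bij_betw_def endo_inj_surj)
qed

text \<open>Affine maps permute the residues, and a periodic \<open>f\<close> does not see the
  reduction modulo q. The shifts, reflections and dilations of the Gauss sum computations are
  instances.\<close>

lemma sum_residues_affine:
  fixes c d :: int and q :: nat and f :: "int \<Rightarrow> 'a::comm_monoid_add"
  assumes "q > 0" "coprime c (int q)" and per: "\<And>x. f (x mod int q) = f x"
  shows "(\<Sum>x\<in>{0..<int q}. f (c * x + d)) = (\<Sum>x\<in>{0..<int q}. f x)"
  using sum.reindex_bij_betw[OF residues_affine_bij[OF assms(1,2), of d], of f] by (simp add: per)

section \<open>The additive character\<close>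

definition add_char :: "nat \<Rightarrow> int \<Rightarrow> complex" where
  "add_char q x = cis (2 * pi * of_int x / of_nat q)"

lemma add_char_add: "add_char q (x + y) = add_char q x * add_char q y"
  by (simp add: add_char_def cis_mult add_divide_distrib distrib_left)

lemma add_char_0 [simp]: "add_char q 0 = 1"
  by (simp add: add_char_def)

lemma add_char_mod [simp]:
  assumes "q > 0"
  shows "add_char q (x mod int q) = add_char q x"
proof -
  have "add_char q (int q * (x div int q)) = 1"
  proof -
    have "2 * pi * of_int (int q * (x div int q)) / of_nat q = 2 * pi * of_int (x div int q)"
      using assms by simp
    thus ?thesis unfolding add_char_def by (simp only: cis_multiple_2pi Ints_of_int)
  qed
  hence "add_char q (x mod int q + int q * (x div int q)) = add_char q (x mod int q)"
    by (subst add_char_add) simp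
  thus ?thesis by simp
qed

lemma add_char_power: "add_char q x ^ k = add_char q (int k * x)"
  by (simp add: add_char_def DeMoivre mult_ac)

text \<open>Shifting by 1 permutes the terms and multiplies the sum by \<open>add_char q 1\<close>,
  which differs from 1 because 1/q is not an integer.\<close>

lemma sum_add_char:
  assumes "q > 1"
  shows "(\<Sum>x\<in>{0..<int q}. add_char q x) = 0"
proof -
  let ?S = "\<Sum>x\<in>{0..<int q}. add_char q x"
  have "?S = (\<Sum>x\<in>{0..<int q}. add_char q (1 * x + 1))"
    by (rule sum_residues_affine[symmetric]) (use assms in auto)
  also have "\<dots> = ?S * add_char q 1"
    by (simp add: add_char_add sum_distrib_right)
  finally have "?S * (add_char q 1 - 1) = 0" by (simp add: algebra_simps)
  moreover have "add_char q 1 \<noteq> 1"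
  proof
    assume "add_char q 1 = 1"
    then obtain k where "2 * pi / of_nat q = of_int k * (2 * pi)"
      by (auto simp: add_char_def complex_eq_iff cos_one_2pi_int)
    hence "1 = real_of_int k * of_nat q" using assms by (simp add: field_simps)
    hence "1 = k * int q" by (metis of_int_1 of_int_eq_iff of_int_mult of_int_of_nat_eq)
    thus False using assms by (metis dvd_triv_right int_dvd_int_iff nat_dvd_1_iff_1 of_nat_1 less_irrefl)
  qed
  ultimately show ?thesis by simp
qed

section \<open>Gauss sums, Jacobi sums and multiplicative characters\<close>

definition gauss_sum :: "nat \<Rightarrow> (int \<Rightarrow> complex) \<Rightarrow> complex" where
  "gauss_sum q \<chi> = (\<Sum>x\<in>{0..<int q}. \<chi> x * add_char q x)"

definition jacobi_sum :: "nat \<Rightarrow> (int \<Rightarrow> complex) \<Rightarrow> (int \<Rightarrow> complex) \<Rightarrow> complex" where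
  "jacobi_sum q \<chi> \<psi> = (\<Sum>x\<in>{0..<int q}. \<chi> x * \<psi> (1 - x))"

text \<open>Dirichlet characters as periodic functions on the integers. The zeros are fixed to be
  the multiples of q, so the trivial character vanishes at 0 and only positive powers of a character
  are characters again.\<close>

definition mult_char :: "nat \<Rightarrow> (int \<Rightarrow> complex) \<Rightarrow> bool" where
  "mult_char q \<chi> \<longleftrightarrow> (\<forall>x. \<chi> (x mod int q) = \<chi> x) \<and> (\<forall>x y. \<chi> (x * y) = \<chi> x * \<chi> y)
     \<and> (\<forall>x. \<chi> x = 0 \<longleftrightarrow> int q dvd x)"

lemma mult_char_mod: "mult_char q \<chi> \<Longrightarrow> \<chi> (x mod int q) = \<chi> x"
  and mult_char_mult: "mult_char q \<chi> \<Longrightarrow> \<chi> (x * y) = \<chi> x * \<chi> y"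
  and mult_char_eq_0_iff: "mult_char q \<chi> \<Longrightarrow> \<chi> x = 0 \<longleftrightarrow> int q dvd x"
  by (auto simp: mult_char_def)

lemma mult_char_cong: "mult_char q \<chi> \<Longrightarrow> [x = y] (mod int q) \<Longrightarrow> \<chi> x = \<chi> y"
  by (metis cong_def mult_char_mod)

lemma mult_char_power: "mult_char q \<chi> \<Longrightarrow> k > 0 \<Longrightarrow> mult_char q (\<lambda>x. \<chi> x ^ k)"
  by (auto simp: mult_char_def power_mult_distrib)

lemma sum_mult_char_eq_0:
  assumes "prime q" "mult_char q \<chi>" "\<not> int q dvd r" "\<chi> r \<noteq> 1"
  shows "(\<Sum>x\<in>{0..<int q}. \<chi> x) = 0"
proof -
  have "coprime r (int q)" using assms(1,3)
    by (metis coprime_commute prime_imp_coprime prime_nat_int_transfer)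
  hence "(\<Sum>x\<in>{0..<int q}. \<chi> (r * x + 0)) = (\<Sum>x\<in>{0..<int q}. \<chi> x)"
    using assms mult_char_mod prime_gt_0_nat by (intro sum_residues_affine) auto
  hence "\<chi> r * (\<Sum>x\<in>{0..<int q}. \<chi> x) = (\<Sum>x\<in>{0..<int q}. \<chi> x)"
    by (simp add: mult_char_mult[OF assms(2)] sum_distrib_left)
  thus ?thesis using assms(4) by simp
qed

text \<open>The dilation of x by z makes both arguments multiples of z.\<close>

lemma sum_char_convolution:
  assumes q: "prime q" and \<chi>: "mult_char q \<chi>" and \<psi>: "mult_char q \<psi>" and z: "\<not> int q dvd z"
  shows "(\<Sum>x\<in>{0..<int q}. \<chi> x * \<psi> (z - x)) = \<chi> z * \<psi> z * jacobi_sum q \<chi> \<psi>"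
proof -
  have "coprime z (int q)" using q z
    by (metis coprime_commute prime_imp_coprime prime_nat_int_transfer)
  hence "(\<Sum>x\<in>{0..<int q}. \<chi> x * \<psi> (z - x)) = (\<Sum>x\<in>{0..<int q}. \<chi> (z*x+0) * \<psi> (z - (z*x+0)))"
  proof (intro sum_residues_affine[symmetric])
    fix x
    have "\<psi> (z - x mod int q) = \<psi> (z - x)"
      by (rule mult_char_cong[OF \<psi>]) (simp add: cong_def mod_diff_right_eq)
    thus "\<chi> (x mod int q) * \<psi> (z - x mod int q) = \<chi> x * \<psi> (z - x)"
      by (simp add: mult_char_mod[OF \<chi>])
  qed (use q prime_gt_0_nat in auto)
  also have "\<dots> = (\<Sum>x\<in>{0..<int q}. \<chi> (z * x) * \<psi> (z * (1 - x)))"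
    by (simp add: algebra_simps)
  also have "\<dots> = \<chi> z * \<psi> z * jacobi_sum q \<chi> \<psi>"
    unfolding jacobi_sum_def sum_distrib_left
    by (simp add: mult_char_mult[OF \<chi>] mult_char_mult[OF \<psi>] mult_ac)
  finally show ?thesis .
qed

text \<open>The double sum is grouped by z = x + y. The part z = 0 gives the first summand and z
  nonzero gives the Jacobi sum by \<open>sum_char_convolution\<close>. The first summand is kept so
  that the formula serves both for a nontrivial product character, where it vanishes, and for
  inverse characters.\<close>

lemma gauss_sum_mult:
  assumes q: "prime q" and \<chi>: "mult_char q \<chi>" and \<psi>: "mult_char q \<psi>"
  shows "gauss_sum q \<chi> * gauss_sum q \<psi> = \<psi> (-1) * (\<Sum>x\<in>{0..<int q}. \<chi> x * \<psi> x) +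
           jacobi_sum q \<chi> \<psi> * gauss_sum q (\<lambda>x. \<chi> x * \<psi> x)"
proof -
  have q0: "q > 0" using q prime_gt_0_nat by blast
  let ?Z = "{0..<int q}"
  have "gauss_sum q \<chi> * gauss_sum q \<psi> = (\<Sum>x\<in>?Z. \<chi> x * add_char q x * (\<Sum>y\<in>?Z. \<psi> y * add_char q y))"
    by (simp add: gauss_sum_def sum_distrib_right)
  \<comment> \<open>The substitution y = z - x in the inner sum.\<close>
  also have "\<dots> = (\<Sum>x\<in>?Z. \<chi> x * add_char q x * (\<Sum>z\<in>?Z. \<psi> (1 * z + (- x)) * add_char q (1 * z + (- x))))"
  proof (rule sum.cong[OF refl], rule arg_cong2[of _ _ _ _ "(*)", OF refl])
    fix x
    show "(\<Sum>y\<in>?Z. \<psi> y * add_char q y) = (\<Sum>z\<in>?Z. \<psi> (1 * z + (- x)) * add_char q (1 * z + (- x)))"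
      by (rule sum_residues_affine[symmetric]) (use q0 mult_char_mod[OF \<psi>] in auto)
  qed
  also have "\<dots> = (\<Sum>x\<in>?Z. \<Sum>z\<in>?Z. \<chi> x * \<psi> (z - x) * add_char q z)"
    unfolding sum_distrib_left
  proof (intro sum.cong refl)
    fix x z
    have "add_char q z = add_char q x * add_char q (z - x)" by (simp flip: add_char_add)
    thus "\<chi> x * add_char q x * (\<psi> (1 * z + - x) * add_char q (1 * z + - x)) = \<chi> x * \<psi> (z - x) * add_char q z"
      by simp
  qed
  also have "\<dots> = (\<Sum>z\<in>?Z. (\<Sum>x\<in>?Z. \<chi> x * \<psi> (z - x)) * add_char q z)"
    by (subst sum.swap) (simp add: sum_distrib_right)
  also have "\<dots> = (\<Sum>z\<in>insert 0 {1..<int q}. (\<Sum>x\<in>?Z. \<chi> x * \<psi> (z - x)) * add_char q z)"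
    using q0 by (intro sum.cong) auto
  also have "\<dots> =
     (\<Sum>x\<in>?Z. \<chi> x * \<psi> (-1 * x)) + (\<Sum>z\<in>{1..<int q}. (\<Sum>x\<in>?Z. \<chi> x * \<psi> (z - x)) * add_char q z)"
    by simp
  also have "(\<Sum>x\<in>?Z. \<chi> x * \<psi> (-1 * x)) = \<psi> (-1) * (\<Sum>x\<in>?Z. \<chi> x * \<psi> x)"
    unfolding mult_char_mult[OF \<psi>] by (simp add: sum_distrib_left mult_ac)
  also have "(\<Sum>z\<in>{1..<int q}. (\<Sum>x\<in>?Z. \<chi> x * \<psi> (z - x)) * add_char q z) =
    (\<Sum>z\<in>{1..<int q}. jacobi_sum q \<chi> \<psi> * (\<chi> z * \<psi> z * add_char q z))"
  proof (rule sum.cong)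
    fix z assume "z \<in> {1..<int q}"
    hence "\<not> int q dvd z" using zdvd_not_zless by auto
    thus "(\<Sum>x\<in>?Z. \<chi> x * \<psi> (z - x)) * add_char q z = jacobi_sum q \<chi> \<psi> * (\<chi> z * \<psi> z * add_char q z)"
      using sum_char_convolution[OF assms] by (simp add: mult_ac)
  qed auto
  \<comment> \<open>The index 0 may be restored because characters vanish there.\<close>
  also have "\<dots> = jacobi_sum q \<chi> \<psi> * (\<Sum>z\<in>insert 0 {1..<int q}. \<chi> z * \<psi> z * add_char q z)"
    using mult_char_eq_0_iff[OF \<chi>, of 0] by (simp add: sum_distrib_left)
  also have "insert 0 {1..<int q} = ?Z" using q0 by auto
  finally show ?thesis by (simp add: gauss_sum_def)
qed

text \<open>Only the term at 0, which is 1, is missing from the complete sum of the additive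
  character.\<close>

lemma gauss_sum_trivial:
  assumes "prime q" "mult_char q \<chi>" "\<And>x. \<not> int q dvd x \<Longrightarrow> \<chi> x = 1"
  shows "gauss_sum q \<chi> = -1" and "(\<Sum>x\<in>{0..<int q}. \<chi> x) = of_nat q - 1"
proof -
  have q1: "q > 1" using assms(1) prime_gt_1_nat by blast
  have Z: "{0..<int q} = insert 0 {1..<int q}" using q1 by auto
  have \<chi>: "\<chi> x = 1" if "x \<in> {1..<int q}" for x using that assms(3) zdvd_not_zless by auto
  have \<chi>0: "\<chi> 0 = 0" using mult_char_eq_0_iff[OF assms(2)] by simp
  show "(\<Sum>x\<in>{0..<int q}. \<chi> x) = of_nat q - 1"
    unfolding Z using \<chi> \<chi>0 q1 by (simp add: of_nat_diff)
  have "gauss_sum q \<chi> = (\<Sum>x\<in>{1..<int q}. add_char q x)"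
    unfolding gauss_sum_def Z using \<chi> \<chi>0 by simp
  also have "\<dots> = (\<Sum>x\<in>{0..<int q}. add_char q x) - 1"
    unfolding Z by simp
  finally show "gauss_sum q \<chi> = -1" using sum_add_char[OF q1] by simp
qed

text \<open>The Jacobi sum is found by summing the convolution over all z. The total is a product of
  two complete character sums, hence 0; z = 0 contributes \<open>\<psi> (-1) * (q - 1)\<close>, and
  each of the other q - 1 values of z contributes the Jacobi sum, which is therefore
  \<open>- \<psi> (-1)\<close>.\<close>

lemma gauss_sum_mult_inverse:
  assumes q: "prime q" and \<chi>: "mult_char q \<chi>" and \<psi>: "mult_char q \<psi>"
    and inv: "\<And>x. \<not> int q dvd x \<Longrightarrow> \<chi> x * \<psi> x = 1" and r: "\<not> int q dvd r" "\<chi> r \<noteq> 1"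
  shows "gauss_sum q \<chi> * gauss_sum q \<psi> = \<psi> (-1) * of_nat q"
proof -
  have q1: "q > 1" using q prime_gt_1_nat by blast
  let ?Z = "{0..<int q}" let ?J = "jacobi_sum q \<chi> \<psi>"
  have Z: "{0..<int q} = insert 0 {1..<int q}" using q1 by auto
  have triv: "mult_char q (\<lambda>x. \<chi> x * \<psi> x)"
    using \<chi> \<psi> by (auto simp: mult_char_def)
  note T = gauss_sum_trivial[OF q triv inv, simplified]
  have sw: "(\<Sum>z\<in>?Z. \<Sum>x\<in>?Z. \<chi> x * \<psi> (z - x)) = 0"
  proof -
    have "(\<Sum>z\<in>?Z. \<Sum>x\<in>?Z. \<chi> x * \<psi> (z - x)) = (\<Sum>x\<in>?Z. \<chi> x * (\<Sum>z\<in>?Z. \<psi> (1 * z + (- x))))"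
      by (subst sum.swap) (simp add: sum_distrib_left)
    also have "\<dots> = (\<Sum>x\<in>?Z. \<chi> x * (\<Sum>z\<in>?Z. \<psi> z))"
      by (rule sum.cong[OF refl], rule arg_cong2[of _ _ _ _ "(*)", OF refl], rule sum_residues_affine)
         (use q1 mult_char_mod[OF \<psi>] in auto)
    also have "\<dots> = (\<Sum>x\<in>?Z. \<chi> x) * (\<Sum>z\<in>?Z. \<psi> z)" by (simp add: sum_distrib_right)
    finally show ?thesis using sum_mult_char_eq_0[OF q \<chi> r] by simp
  qed
  have "(\<Sum>z\<in>?Z. \<Sum>x\<in>?Z. \<chi> x * \<psi> (z - x)) = (\<Sum>x\<in>?Z. \<chi> x * \<psi> (-1 * x)) +
     (\<Sum>z\<in>{1..<int q}. \<Sum>x\<in>?Z. \<chi> x * \<psi> (z - x))"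
    by (subst (1) Z) simp
  also have "(\<Sum>x\<in>?Z. \<chi> x * \<psi> (-1 * x)) = \<psi> (-1) * (\<Sum>x\<in>?Z. \<chi> x * \<psi> x)"
    unfolding mult_char_mult[OF \<psi>] by (simp add: sum_distrib_left mult_ac)
  also have "(\<Sum>z\<in>{1..<int q}. \<Sum>x\<in>?Z. \<chi> x * \<psi> (z - x)) = (\<Sum>z\<in>{1..<int q}. ?J)"
  proof (rule sum.cong)
    fix z assume "z \<in> {1..<int q}"
    hence "\<not> int q dvd z" using zdvd_not_zless by auto
    thus "(\<Sum>x\<in>?Z. \<chi> x * \<psi> (z - x)) = ?J"
      using sum_char_convolution[OF q \<chi> \<psi>] inv by simp
  qed auto
  also have "\<dots> = (of_nat q - 1) * ?J" using q1 by (simp add: of_nat_diff)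
  finally have "0 = \<psi> (-1) * (of_nat q - 1) + (of_nat q - 1) * ?J"
    unfolding sw T(2) .
  hence "(of_nat q - 1) * (\<psi> (-1) + ?J) = 0" by (simp only: distrib_left mult.commute)
  hence "?J = - \<psi> (-1)" using q1 by (simp add: eq_neg_iff_add_eq_0 add.commute)
  thus ?thesis using gauss_sum_mult[OF q \<chi> \<psi>] T by (simp add: algebra_simps)
qed

lemma gauss_sum_cyclo_ints:
  assumes "N > 0" "q dvd N" "\<And>x. \<chi> x \<in> cyclo_ints N"
  shows "gauss_sum q \<chi> \<in> cyclo_ints N"
  unfolding gauss_sum_def add_char_def using assms
  by (intro cyclo_ints_sum cyclo_ints_mult cyclo_ints_cis) auto

text \<open>Frobenius acts termwise and turns the additive character at x into the one at p x. The
  factor \<open>\<chi> (int p) ^ p\<close> is what the substitution of p x for x requires; it stays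
  on the left to avoid a division.\<close>

lemma gauss_sum_frobenius:
  assumes N: "N > 0" "q dvd N" and \<chi>R: "\<And>x. \<chi> x \<in> cyclo_ints N"
    and q: "prime q" and p: "prime p" "p \<noteq> q" and \<chi>: "mult_char q \<chi>" 
  shows "cyclo_cong N p (\<chi> (int p) ^ p * gauss_sum q \<chi> ^ p) (gauss_sum q (\<lambda>x. \<chi> x ^ p))"
proof -
  let ?Z = "{0..<int q}"
  have q0: "q > 0" using q prime_gt_0_nat by blast
  have p0: "p > 0" using p prime_gt_0_nat by blast
  have \<psi>: "mult_char q (\<lambda>x. \<chi> x ^ p)" using \<chi> p0 by (rule mult_char_power)
  have "cyclo_cong N p (gauss_sum q \<chi> ^ p) (\<Sum>x\<in>?Z. (\<chi> x * add_char q x) ^ p)"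
    unfolding gauss_sum_def add_char_def using assms
    by (intro cyclo_cong_frobenius_sum cyclo_ints_mult cyclo_ints_cis) auto
  hence "cyclo_cong N p (\<chi> (int p) ^ p * gauss_sum q \<chi> ^ p)
      (\<chi> (int p) ^ p * (\<Sum>x\<in>?Z. (\<chi> x * add_char q x) ^ p))"
    using N \<chi>R by (intro cyclo_cong_mult_left cyclo_ints_power) auto
  also have "\<chi> (int p) ^ p * (\<Sum>x\<in>?Z. (\<chi> x * add_char q x) ^ p) =
      (\<Sum>x\<in>?Z. \<chi> (int p * x + 0) ^ p * add_char q (int p * x + 0))"
    by (simp add: sum_distrib_left power_mult_distrib add_char_power mult_char_mult[OF \<chi>] mult_ac)
  also have "\<dots> = gauss_sum q (\<lambda>x. \<chi> x ^ p)"
    unfolding gauss_sum_def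
    by (rule sum_residues_affine)
       (use q p q0 in \<open>auto simp: mult_char_mod[OF \<chi>] primes_coprime\<close>)
  finally show ?thesis .
qed

text \<open>Dilation by a primitive root r multiplies the sum by r^j, which is not 1 modulo q for 0
  < j < q - 1. For j = 0 every term is 1, including 0^0, and the sum is q.\<close>

lemma sum_powers_residues:
  assumes q: "prime q" and j: "j < q - 1"
  shows "[(\<Sum>x\<in>{0..<int q}. x ^ j) = 0] (mod int q)"
proof (cases "j = 0")
  case False
  have q1: "q > 1" using q prime_gt_1_nat by blast
  obtain r where r: "residue_primroot q r" using prime_primitive_root_exists[OF q1] q by blast
  have cop: "coprime q r" and ord: "ord q r = q - 1"
    using r q by (auto simp: residue_primroot_def totient_prime)
  have nd: "\<not> q - 1 dvd j" using False j by (auto dest: dvd_imp_le)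
  have "\<not> [r ^ j = 1] (mod q)" using nd ord by (metis ord_divides)
  hence n: "\<not> [int r ^ j = 1] (mod int q)" by (metis cong_int_iff of_nat_1 of_nat_power)
  \<comment> \<open>\<open>sum_residues_affine\<close> asks for exact periodicity, so the powers are
    reduced modulo q first.\<close>
  let ?f = "\<lambda>x::int. x ^ j mod int q"
  have "(\<Sum>x\<in>{0..<int q}. ?f (int r * x + 0)) = (\<Sum>x\<in>{0..<int q}. ?f x)"
    using q1 cop by (intro sum_residues_affine) (auto simp: power_mod coprime_commute)
  hence "(\<Sum>x\<in>{0..<int q}. ?f (int r * x)) mod int q = (\<Sum>x\<in>{0..<int q}. ?f x) mod int q" by simp
  hence "[(\<Sum>x\<in>{0..<int q}. (int r * x) ^ j) = (\<Sum>x\<in>{0..<int q}. x ^ j)] (mod int q)"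
    by (simp add: mod_sum_eq cong_def)
  also have "(\<Sum>x\<in>{0..<int q}. (int r * x) ^ j) = int r ^ j * (\<Sum>x\<in>{0..<int q}. x ^ j)"
    by (simp add: power_mult_distrib sum_distrib_left)
  finally have "int q dvd (int r ^ j - 1) * (\<Sum>x\<in>{0..<int q}. x ^ j)"
    by (simp add: cong_iff_dvd_diff algebra_simps)
  moreover have "\<not> int q dvd int r ^ j - 1" using n by (simp add: cong_iff_dvd_diff)
  ultimately have "int q dvd (\<Sum>x\<in>{0..<int q}. x ^ j)"
    using q prime_dvd_mult_iff[of "int q"] by auto
  thus ?thesis by (simp add: cong_0_iff)
qed (use prime_gt_0_nat[OF q] in \<open>simp add: cong_0_iff\<close>)

section \<open>The quartic character and its Jacobi sum\<close>

text \<open>The value is read off from x^((q-1)/4), a fourth root of unity modulo q, by sending m to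
  i. Since m has order 4 modulo q, the chosen exponent does not matter.\<close>

definition quartic_char :: "nat \<Rightarrow> int \<Rightarrow> int \<Rightarrow> complex" where
  "quartic_char q m x = (if int q dvd x then 0 
     else \<i> ^ (SOME k. [x ^ ((q - 1) div 4) = m ^ k] (mod int q)))"

text \<open>The second component is the image of the Gaussian integer under the ring homomorphism
  to the residues modulo \<open>q\<close> that sends the imaginary unit to \<open>m\<close>.\<close>
definition gauss_int_res :: "nat \<Rightarrow> int \<Rightarrow> complex \<Rightarrow> int \<Rightarrow> bool" where
  "gauss_int_res q m z r \<longleftrightarrow> (\<exists>A B. z = of_int A + of_int B * \<i> \<and> [A + B * m = r] (mod int q))"

lemma power_power_swap: "(a ^ j) ^ k = (a ^ k) ^ j" for a :: "'a :: monoid_mult"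
  by (metis mult.commute power_mult)

text \<open>Choosing one of the two square roots of -1 modulo q amounts to choosing a Gaussian prime
  above q.\<close>

locale quartic_setup =
  fixes q e :: nat and m :: int
  assumes q: "prime q" and q_eq: "q = 4 * e + 1" and m: "[m\<^sup>2 = -1] (mod int q)"
begin

abbreviation "\<chi> \<equiv> quartic_char q m"

lemma quartic_char_def': "quartic_char q m x = (if int q dvd x then 0 
     else \<i> ^ (SOME k. [x ^ e = m ^ k] (mod int q)))"
  by (simp add: quartic_char_def q_eq)

lemma e_pos: "e > 0"
  using q_eq prime_gt_1_nat[OF q] by (cases "e = 0") auto

lemma q_ge_5: "q \<ge> 5" using q_eq e_pos by linarith

lemma prime_int_q: "prime (int q)" using q by simp

lemma m_even_power: "[m ^ (2 * k) = (-1) ^ k] (mod int q)"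
  unfolding power_mult using m by (rule cong_pow)

lemma not_cong_minus_1_1: "\<not> [-1 = 1] (mod int q)"
  using q_ge_5 zdvd_not_zless[of 2 "int q"] by (auto simp: cong_iff_dvd_diff)

lemma coprime_m: "coprime m (int q)"
proof -
  have "[m * (- m) = 1] (mod int q)" 
    using cong_minus_minus_iff[of "m\<^sup>2" "-1" "int q"] m by (simp add: power2_eq_square)
  thus ?thesis using coprime_iff_invertible_int by blast
qed

text \<open>Shows that 4 divides the difference d of the exponents: an odd d gives -1 = 1 modulo q
  after squaring, and for d = 2 l the congruence m^2 = -1 forces l to be even.\<close>

lemma ii_power_eq_if_m_power_cong:
  assumes "[m ^ j = m ^ k] (mod int q)" "j \<le> k"
  shows "\<i> ^ j = \<i> ^ k"
proof -
  define d where "d = k - j"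
  have k: "k = j + d" using assms(2) by (simp add: d_def)
  have "coprime (m ^ j) (int q)" using coprime_m by simp
  hence d: "[1 = m ^ d] (mod int q)"
    using assms(1) cong_mult_lcancel[of "m ^ j" "int q" 1 "m ^ d"] by (simp add: k power_add)
  have "even d"
  proof (rule ccontr)
    assume "odd d"
    from d have "[1 ^ 2 = (m ^ d) ^ 2] (mod int q)" by (rule cong_pow)
    also have "(m ^ d) ^ 2 = m ^ (2 * d)" by (simp add: power_mult mult.commute)
    also have "[m ^ (2 * d) = (-1) ^ d] (mod int q)" by (rule m_even_power)
    finally show False using \<open>odd d\<close> not_cong_minus_1_1 by (simp add: cong_sym_eq)
  qed
  then obtain l where l: "d = 2 * l" by auto
  have "[1 = (-1) ^ l] (mod int q)" using cong_trans[OF d] m_even_power l by blast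
  hence "even l" using not_cong_minus_1_1 by (cases "even l") (auto simp: cong_sym_eq)
  thus ?thesis by (auto simp: k l power_add power_mult elim!: evenE)
qed

lemma fourth_root_cases:
  assumes "\<not> int q dvd x"
  obtains k where "[x ^ e = m ^ k] (mod int q)"
proof -
  define y where "y = x ^ e"
  have "\<not> q dvd nat \<bar>x\<bar>" using assms by (simp add: dvd_nat_abs_iff)
  hence "[nat \<bar>x\<bar> ^ (q - 1) = 1] (mod q)" using fermat_theorem[OF q] by blast
  hence "[int (nat \<bar>x\<bar> ^ (q - 1)) = int 1] (mod int q)" by (simp only: cong_int_iff)
  moreover have "int (nat \<bar>x\<bar> ^ (q - 1)) = y ^ 4"
  proof -
    have "q - 1 = e * 4" using q_eq by linarith
    hence "int (nat \<bar>x\<bar> ^ (q - 1)) = (\<bar>x\<bar> ^ e) ^ 4" by (simp add: power_mult)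
    thus ?thesis by (simp add: y_def flip: power_abs)
  qed
  ultimately have "int q dvd y ^ 4 - 1" by (simp add: cong_iff_dvd_diff)
  \<comment> \<open>Subtracting this multiple of q replaces the factor y^2 + 1 of y^4 - 1 by y^2 -
    m^2, so that only linear factors remain.\<close>
  moreover have "int q dvd (y ^ 2 - 1) * (m ^ 2 + 1)"
    using m by (simp add: cong_iff_dvd_diff)
  ultimately have "int q dvd (y ^ 4 - 1) - (y ^ 2 - 1) * (m ^ 2 + 1)" by (rule dvd_diff)
  also have "(y ^ 4 - 1) - (y ^ 2 - 1) * (m ^ 2 + 1) = (y - 1) * (y + 1) * ((y - m) * (y + m))"
    by (simp add: algebra_simps power2_eq_square power4_eq_xxxx)
  finally consider "int q dvd y - 1" | "int q dvd y + 1" | "int q dvd y - m" | "int q dvd y + m"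
    using prime_int_q by (auto simp: prime_dvd_mult_iff)
  thus ?thesis
  proof cases
    case 1 thus ?thesis using that[of 0] by (simp add: cong_iff_dvd_diff y_def)
  next
    case 2
    hence "[y = -1] (mod int q)" by (simp add: cong_iff_dvd_diff)
    thus ?thesis using that[of 2] cong_trans[OF _ cong_sym[OF m]] by (simp add: y_def)
  next
    case 3 thus ?thesis using that[of 1] by (simp add: cong_iff_dvd_diff y_def)
  next
    case 4
    hence "[y = - m] (mod int q)" by (simp add: cong_iff_dvd_diff)
    moreover have "[m ^ 3 = - m] (mod int q)" 
      using cong_mult[OF m cong_refl[of m]] by (simp add: power2_eq_square power3_eq_cube)
    ultimately show ?thesis using that[of 3] cong_trans[OF _ cong_sym] y_def by blast
  qed
qed

lemma quartic_char_eq: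
  assumes "\<not> int q dvd x" "[x ^ e = m ^ k] (mod int q)"
  shows "\<chi> x = \<i> ^ k"
proof -
  define l where "l = (SOME k. [x ^ e = m ^ k] (mod int q))"
  have "[x ^ e = m ^ l] (mod int q)"
    unfolding l_def by (rule someI) (rule assms(2))
  hence kl: "[m ^ k = m ^ l] (mod int q)" using assms(2) cong_sym cong_trans by blast
  have "\<i> ^ l = \<i> ^ k"
    using ii_power_eq_if_m_power_cong[OF kl] ii_power_eq_if_m_power_cong[OF cong_sym[OF kl]]
    by (metis nat_le_linear)
  thus ?thesis using assms(1) by (simp add: quartic_char_def' l_def)
qed

lemma quartic_char_cases:
  assumes "\<not> int q dvd x"
  obtains k where "[x ^ e = m ^ k] (mod int q)" "\<chi> x = \<i> ^ k"
proof -
  obtain k where "[x ^ e = m ^ k] (mod int q)" using assms by (rule fourth_root_cases)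
  with quartic_char_eq[OF assms] show ?thesis using that by blast
qed

lemma quartic_char_dvd: "int q dvd x \<Longrightarrow> \<chi> x = 0"
  by (simp add: quartic_char_def')

lemma mult_char_quartic: "mult_char q \<chi>"
  unfolding mult_char_def
proof (intro conjI allI)
  fix x y
  show "\<chi> (x mod int q) = \<chi> x" by (simp add: quartic_char_def' dvd_mod_iff power_mod cong_def)
  show "\<chi> x = 0 \<longleftrightarrow> int q dvd x" by (simp add: quartic_char_def')
  show "\<chi> (x * y) = \<chi> x * \<chi> y"
  proof (cases "int q dvd x \<or> int q dvd y")
    case True thus ?thesis by (auto simp: quartic_char_dvd)
  next
    case False
    then obtain j k where j: "[x ^ e = m ^ j] (mod int q)" "\<chi> x = \<i> ^ j"
      and k: "[y ^ e = m ^ k] (mod int q)" "\<chi> y = \<i> ^ k"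
      using quartic_char_cases by metis
    have "[(x * y) ^ e = m ^ (j + k)] (mod int q)"
      using cong_mult[OF j(1) k(1)] by (simp add: power_mult_distrib power_add)
    moreover have "\<not> int q dvd x * y" using False prime_int_q by (simp add: prime_dvd_mult_iff)
    ultimately have "\<chi> (x * y) = \<i> ^ (j + k)" by (intro quartic_char_eq)
    thus ?thesis by (simp add: j k power_add)
  qed
qed

lemma quartic_char_power4: "\<not> int q dvd x \<Longrightarrow> \<chi> x ^ 4 = 1"
  by (erule quartic_char_cases) (simp only: power_power_swap[of \<i> _ 4], simp)

text \<open>At multiples of q the value is 0, and 0^0 = 1 would break the equality; hence the
  positive exponents.\<close>

lemma quartic_char_power_mod4:
  assumes "[j = k] (mod 4)" "j > 0" "k > 0"
  shows "\<chi> x ^ j = \<chi> x ^ k"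
proof (cases "int q dvd x")
  case False
  have red: "\<chi> x ^ j = \<chi> x ^ (j mod 4)" for j
  proof -
    have "\<chi> x ^ (4 * (j div 4) + j mod 4) = \<chi> x ^ (j mod 4)"
      unfolding power_add power_mult by (simp add: quartic_char_power4[OF False])
    thus ?thesis by simp
  qed
  show ?thesis using red[of j] red[of k] assms(1) by (simp add: cong_def)
qed (use assms in \<open>simp add: quartic_char_dvd power_0_left\<close>)

lemma quartic_char_minus_1: "\<chi> (-1) = (-1) ^ e"
proof -
  have "\<not> int q dvd -1" using q_ge_5 by auto
  moreover have "[(-1) ^ e = m ^ (2 * e)] (mod int q)" by (rule cong_sym) (rule m_even_power)
  ultimately have "\<chi> (-1) = \<i> ^ (2 * e)" by (rule quartic_char_eq)
  thus ?thesis by (simp add: power_mult)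
qed

text \<open>A witness that the character and its square are both nontrivial. For a primitive root
  the exponent k must be odd, since an even one would make the order divide 2 e, half of q -
  1.\<close>

lemma exists_quartic_char_square:
  obtains r where "\<not> int q dvd r" "(\<chi> r)\<^sup>2 = -1"
proof -
  have q1: "q > 1" using q_ge_5 by simp
  obtain r where r: "residue_primroot q r" using prime_primitive_root_exists[OF q1] q by blast
  have cop: "coprime q r" and ord: "ord q r = q - 1"
    using r q by (auto simp: residue_primroot_def totient_prime)
  have nd: "\<not> int q dvd int r"
  proof
    assume "int q dvd int r"
    hence "is_unit q" using coprime_common_divisor[OF cop, of q] by simp
    thus False using q1 by simp
  qed
  obtain k where k: "[int r ^ e = m ^ k] (mod int q)" "\<chi> (int r) = \<i> ^ k"
    using quartic_char_cases[OF nd] .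
  have "odd k"
  proof
    assume "even k"
    from k(1) have "[(int r ^ e) ^ 2 = (m ^ k) ^ 2] (mod int q)" by (rule cong_pow)
    hence "[int r ^ (2 * e) = m ^ (2 * k)] (mod int q)" by (simp add: mult.commute power_mult power_power_swap[of _ 2])
    hence "[int r ^ (2 * e) = (-1) ^ k] (mod int q)" using m_even_power cong_trans by blast
    hence "[int (r ^ (2 * e)) = int 1] (mod int q)" using \<open>even k\<close> by simp
    hence "[r ^ (2 * e) = 1] (mod q)" by (simp only: cong_int_iff)
    hence "q - 1 dvd 2 * e" using ord ord_divides by metis
    hence "q - 1 \<le> 2 * e" using e_pos by (intro dvd_imp_le) auto
    thus False using q_eq e_pos by linarith
  qed
  hence "(\<chi> (int r))\<^sup>2 = -1" by (simp add: k(2) power_power_swap[of \<i> _ 2])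
  thus ?thesis using that nd by blast
qed

lemma cnj_quartic_char: "cnj (\<chi> x) = \<chi> x ^ 3"
proof (cases "int q dvd x")
  case False
  then obtain k where "\<chi> x = \<i> ^ k" using quartic_char_cases by blast
  moreover have "(- \<i>) ^ k = (\<i> ^ k) ^ 3"
    using power_power_swap[of \<i> 3 k] by (simp add: power3_eq_cube)
  ultimately show ?thesis by simp
qed (simp add: quartic_char_dvd)

section \<open>Reduction of Gaussian integers modulo the prime above q\<close>

lemma gauss_int_resE:
  assumes "gauss_int_res q m z r"
  obtains A B where "z = of_int A + of_int B * \<i>" "[A + B * m = r] (mod int q)"
  using assms unfolding gauss_int_res_def by (elim exE conjE)

lemma gauss_int_res_mult:
  assumes "gauss_int_res q m z r" "gauss_int_res q m w s"
  shows "gauss_int_res q m (z * w) (r * s)"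
proof -
  obtain A B where AB: "z = of_int A + of_int B * \<i>" "[A + B * m = r] (mod int q)"
    using assms(1) by (rule gauss_int_resE)
  obtain C D where CD: "w = of_int C + of_int D * \<i>" "[C + D * m = s] (mod int q)"
    using assms(2) by (rule gauss_int_resE)
  note * = AB CD
  have "z * w = of_int (A * C - B * D) + of_int (A * D + B * C) * \<i>"
    unfolding *(1,3) by (simp add: complex_eq_iff)
  moreover have "[(A * C - B * D) + (A * D + B * C) * m = r * s] (mod int q)"
  proof -
    have "[(A * C - B * D) + (A * D + B * C) * m = A * C + B * D * m\<^sup>2 + (A * D + B * C) * m] (mod int q)"
    proof -
      have "[A * C + B * D * (-1) + (A * D + B * C) * m = A * C + B * D * m\<^sup>2 + (A * D + B * C) * m] (mod int q)"
        by (intro cong_add cong_mult cong_refl cong_sym[OF m])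
      thus ?thesis by simp
    qed
    also have "A * C + B * D * m\<^sup>2 + (A * D + B * C) * m = (A + B * m) * (C + D * m)"
      by (simp add: algebra_simps power2_eq_square)
    also have "[(A + B * m) * (C + D * m) = r * s] (mod int q)" by (intro cong_mult *)
    finally show ?thesis .
  qed
  ultimately show ?thesis unfolding gauss_int_res_def by (intro exI conjI)
qed

lemma gauss_int_res_add:
  assumes "gauss_int_res q m z r" "gauss_int_res q m w s"
  shows "gauss_int_res q m (z + w) (r + s)"
proof -
  obtain A B where AB: "z = of_int A + of_int B * \<i>" "[A + B * m = r] (mod int q)"
    using assms(1) by (rule gauss_int_resE)
  obtain C D where CD: "w = of_int C + of_int D * \<i>" "[C + D * m = s] (mod int q)"
    using assms(2) by (rule gauss_int_resE)
  note * = AB CD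
  have "z + w = of_int (A + C) + of_int (B + D) * \<i>"
    unfolding *(1,3) by (simp add: complex_eq_iff)
  moreover have "[(A + C) + (B + D) * m = r + s] (mod int q)"
    using cong_add[OF *(2,4)] by (simp add: algebra_simps)
  ultimately show ?thesis unfolding gauss_int_res_def by (intro exI conjI)
qed

lemma gauss_int_res_1: "gauss_int_res q m 1 1"
  unfolding gauss_int_res_def by (intro exI[of _ 1] exI[of _ 0]) auto

lemma gauss_int_res_0: "gauss_int_res q m 0 0"
  unfolding gauss_int_res_def by (intro exI[of _ 0]) auto

lemma gauss_int_res_ii_power: "gauss_int_res q m (\<i> ^ k) (m ^ k)"
proof (induction k)
  case (Suc k)
  have "gauss_int_res q m \<i> m"
    unfolding gauss_int_res_def by (intro exI[of _ 0] exI[of _ 1]) auto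
  from gauss_int_res_mult[OF this Suc.IH] show ?case by simp
qed (simp add: gauss_int_res_1)

lemma gauss_int_res_sum:
  "(\<And>i. i \<in> I \<Longrightarrow> gauss_int_res q m (f i) (g i)) \<Longrightarrow> gauss_int_res q m (sum f I) (sum g I)"
  by (induction I rule: infinite_finite_induct) (auto simp: gauss_int_res_0 intro: gauss_int_res_add)

lemma gauss_int_res_cong:
  "gauss_int_res q m z r \<Longrightarrow> [r = s] (mod int q) \<Longrightarrow> gauss_int_res q m z s"
  by (elim gauss_int_resE) (auto simp: gauss_int_res_def intro: cong_trans)

text \<open>Euler's criterion for the quartic character. It turns a character sum into a power sum
  modulo q.\<close>

lemma gauss_int_res_quartic_char: "gauss_int_res q m (\<chi> x) (x ^ e)"
proof (cases "int q dvd x")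
  case True
  hence "int q dvd x ^ e" using e_pos by (meson dvd_power dvd_trans)
  hence "[0 = x ^ e] (mod int q)" by (simp add: cong_iff_dvd_diff)
  thus ?thesis using True gauss_int_res_cong[OF gauss_int_res_0] by (simp add: quartic_char_dvd)
next
  case False
  then obtain k where "[x ^ e = m ^ k] (mod int q)" "\<chi> x = \<i> ^ k" by (rule quartic_char_cases)
  thus ?thesis using gauss_int_res_cong[OF gauss_int_res_ii_power] cong_sym by metis
qed

text \<open>After expanding the binomial only powers of exponent at most 2 e occur, below q - 1 = 4
  e, and each of their sums vanishes.\<close>

lemma sum_power_product_cong_0:
  "[(\<Sum>x\<in>{0..<int q}. x ^ e * (1 - x) ^ e) = 0] (mod int q)"
proof -
  have "(1 - x) ^ e = (\<Sum>k\<le>e. of_nat (e choose k) * (-1) ^ k * x ^ k)" for x :: int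
    using binomial_ring[of "- x" 1 e] by (simp add: power_minus[of x] mult.assoc)
  hence "(\<Sum>x\<in>{0..<int q}. x ^ e * (1 - x) ^ e) =
      (\<Sum>x\<in>{0..<int q}. x ^ e * (\<Sum>k\<le>e. of_nat (e choose k) * (-1) ^ k * x ^ k))" by simp
  also have "\<dots> = (\<Sum>x\<in>{0..<int q}. \<Sum>k\<le>e. of_nat (e choose k) * (-1) ^ k * x ^ (e + k))"
    by (simp add: sum_distrib_left power_add mult_ac)
  also have "\<dots> = (\<Sum>k\<le>e. of_nat (e choose k) * (-1) ^ k * (\<Sum>x\<in>{0..<int q}. x ^ (e + k)))"
    by (subst sum.swap) (simp add: sum_distrib_left)
  also have "[\<dots> = (\<Sum>k\<le>e. of_nat (e choose k) * (-1) ^ k * 0)] (mod int q)"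
  proof (intro cong_sum cong_mult cong_refl sum_powers_residues q)
    fix k assume "k \<in> {..e}"
    thus "e + k < q - 1" using q_eq e_pos by auto
  qed
  finally show ?thesis by simp
qed

abbreviation "J \<equiv> jacobi_sum q \<chi> \<chi>"

text \<open>Places J in the kernel of i -> m, that is, in the chosen prime ideal above q.\<close>

lemma jacobi_sum_gauss_int:
  obtains A B where "J = of_int A + of_int B * \<i>" "[A + B * m = 0] (mod int q)"
proof -
  have "gauss_int_res q m J (\<Sum>x\<in>{0..<int q}. x ^ e * (1 - x) ^ e)"
    unfolding jacobi_sum_def
    by (intro gauss_int_res_sum gauss_int_res_mult gauss_int_res_quartic_char)
  hence "gauss_int_res q m J 0" using sum_power_product_cong_0 by (rule gauss_int_res_cong)
  thus ?thesis using that by (rule gauss_int_resE)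
qed

text \<open>The involution \<open>x \<mapsto> 1 - x\<close> pairs equal terms of the Jacobi sum and has the single fixed point
  \<open>2 * e + 1\<close>, which contributes \<open>\<plusminus>1\<close>.\<close>
lemma jacobi_sum_odd_real_part:
  assumes "J = of_int A + of_int B * \<i>"
  shows "odd A"
proof -
  define f where "f x = \<chi> x * \<chi> (1 - x)" for x
  let ?h = "2 * int e + 1"
  have qi: "int q = 4 * int e + 1" using q_eq by linarith
  have [simp]: "f 0 = 0" "f 1 = 0" by (simp_all add: f_def quartic_char_dvd)
  have "{0..<int q} = insert 0 (insert 1 (insert ?h ({2..2 * int e} \<union> {2 * int e + 2..4 * int e})))"
    using qi e_pos by auto
  hence "J = (\<Sum>x\<in>insert 0 (insert 1 (insert ?h ({2..2 * int e} \<union> {2 * int e + 2..4 * int e}))). f x)"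
    by (simp add: jacobi_sum_def f_def)
  also have "\<dots> = f ?h + ((\<Sum>x\<in>{2..2 * int e}. f x) + (\<Sum>x\<in>{2 * int e + 2..4 * int e}. f x))"
    using e_pos by (simp add: sum.union_disjoint)
  also have "(\<Sum>x\<in>{2 * int e + 2..4 * int e}. f x) = (\<Sum>x\<in>{2..2 * int e}. f x)"
  proof (rule sum.reindex_bij_witness[of _ "\<lambda>x. 4 * int e + 2 - x" "\<lambda>x. 4 * int e + 2 - x"])
    fix x
    \<comment> \<open>This is 1 - x + q: the involution with its value moved back into the range of
      summation.\<close>
    have "4 * int e + 2 - x - (1 - x) = int q" "1 - (4 * int e + 2 - x) - x = - int q"
      by (simp_all add: qi)
    hence "\<chi> (4 * int e + 2 - x) = \<chi> (1 - x)" "\<chi> (1 - (4 * int e + 2 - x)) = \<chi> x"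
      by (auto intro!: mult_char_cong[OF mult_char_quartic] simp only: cong_iff_dvd_diff dvd_minus_iff dvd_refl)
    thus "f (4 * int e + 2 - x) = f x" by (simp add: f_def)
  qed auto
  finally have J: "J = f ?h + 2 * (\<Sum>x\<in>{2..2 * int e}. f x)" by simp
  have "gauss_int_res q m (\<Sum>x\<in>{2..2 * int e}. f x) (\<Sum>x\<in>{2..2 * int e}. x ^ e * (1 - x) ^ e)"
    unfolding f_def by (intro gauss_int_res_sum gauss_int_res_mult gauss_int_res_quartic_char)
  then obtain C D where CD: "(\<Sum>x\<in>{2..2 * int e}. f x) = of_int C + of_int D * \<i>"
    by (rule gauss_int_resE)
  have "1 - ?h - ?h = - int q" by (simp add: qi)
  hence "\<chi> (1 - ?h) = \<chi> ?h"
    by (intro mult_char_cong[OF mult_char_quartic]) (simp only: cong_iff_dvd_diff dvd_minus_iff dvd_refl)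
  hence fh: "f ?h = (\<chi> ?h)\<^sup>2" by (simp add: f_def power2_eq_square)
  have "\<not> int q dvd ?h" using zdvd_not_zless[of ?h "int q"] qi e_pos by auto
  then obtain k where "\<chi> ?h = \<i> ^ k" using quartic_char_cases by blast
  hence "f ?h = (-1) ^ k" by (simp add: fh power_power_swap[of \<i> _ 2])
  hence "of_int A + of_int B * \<i> = (-1) ^ k + 2 * (of_int C + of_int D * \<i>)" using J CD assms by simp
  hence "Re (of_int A + of_int B * \<i>) = Re ((-1) ^ k + 2 * (of_int C + of_int D * \<i>))" by simp
  hence "real_of_int A = (-1) ^ k + 2 * of_int C" by (cases "even k") auto
  hence "real_of_int A = of_int ((-1) ^ k + 2 * C)" by simp
  hence "A = (-1) ^ k + 2 * C" by (simp only: of_int_eq_iff)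
  thus ?thesis by simp
qed

end

section \<open>Congruences modulo an odd prime\<close>

text \<open>The second supplement to quadratic reciprocity. With x a primitive eighth root of unity
  and y its inverse, x + y is the square root of 2, and Frobenius evaluates its p-th power.\<close>

lemma two_power_half_cong:
  fixes p :: nat
  assumes p: "prime p" "odd p"
  shows "[2 ^ ((p - 1) div 2) = (-1) ^ ((p\<^sup>2 - 1) div 8)] (mod int p)"
proof -
  define n where "n = (p - 1) div 2"
  define x where "x = cis (pi / 4)"
  define y where "y = cis (- (pi / 4))"
  have N: "(8::nat) > 0" by simp
  have pn: "p = 2 * n + 1" using p(2) by (auto simp: n_def elim!: oddE)
  have xy: "x \<in> cyclo_ints 8" "y \<in> cyclo_ints 8"
    using cyclo_ints_cis[OF N, of 8 1] cyclo_ints_cis[OF N, of 8 "-1"] by (simp_all add: x_def y_def)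
  have sq: "(x + y)\<^sup>2 = 2"
    by (simp add: x_def y_def complex_eq_iff power2_eq_square cos_45 sin_45)
  have frob: "x ^ p + y ^ p = of_int ((-1) ^ ((p\<^sup>2 - 1) div 8)) * (x + y)"
  proof -
    define j where "j = p div 8"
    have trig: "x ^ p + y ^ p = of_real (2 * cos (of_nat p * pi / 4))"
      by (simp add: x_def y_def DeMoivre complex_eq_iff)
    have xy': "x + y = of_real (2 * cos (pi / 4))" by (simp add: x_def y_def complex_eq_iff)
    \<comment> \<open>Only p modulo 8 matters, which leaves four cosines to compare.\<close>
    have cs: "cos (of_nat p * pi / 4) = cos (of_nat (p mod 8) * pi / 4)"
    proof -
      have *: "of_nat p * pi / 4 = of_nat (p mod 8) * pi / 4 + 2 * of_nat j * pi"
      proof -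
        have "real p = of_nat (8 * j + p mod 8)" by (simp add: j_def)
        thus ?thesis by (simp add: field_simps)
      qed
      show ?thesis unfolding * cos_add by (simp only: cos_2npi sin_2npi mult_1_right mult_zero_right diff_zero)
    qed
    have "p mod 8 \<in> {1, 3, 5, 7}" using p(2) by (auto simp: odd_iff_mod_2_eq_one) presburger
    then consider "p mod 8 = 1" | "p mod 8 = 3" | "p mod 8 = 5" | "p mod 8 = 7" by auto
    thus ?thesis
    proof cases
      case 1
      have "p = 8 * j + 1" using 1 by (simp add: j_def) presburger
      hence "p\<^sup>2 - 1 = 8 * (2 * (4 * j * j + j))" by (simp add: power2_eq_square algebra_simps)
      hence "even ((p\<^sup>2 - 1) div 8)" by simp
      thus ?thesis by (simp add: trig xy' cs 1)
    next
      case 2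
      have "p = 8 * j + 3" using 2 by (simp add: j_def) presburger
      hence "p\<^sup>2 - 1 = 8 * (2 * (4 * j * j + 3 * j) + 1)" by (simp add: power2_eq_square algebra_simps)
      hence "odd ((p\<^sup>2 - 1) div 8)" by simp
      moreover have "cos (3 * pi / 4) = - cos (pi / 4)"
        using cos_pi_minus[of "pi / 4"] by (simp add: field_simps)
      ultimately show ?thesis by (simp add: trig xy' cs 2)
    next
      case 3
      have "p = 8 * j + 5" using 3 by (simp add: j_def) presburger
      hence "p\<^sup>2 - 1 = 8 * (2 * (4 * j * j + 5 * j + 1) + 1)" by (simp add: power2_eq_square algebra_simps)
      hence "odd ((p\<^sup>2 - 1) div 8)" by simp
      moreover have "cos (5 * pi / 4) = - cos (pi / 4)"
        using cos_periodic_pi[of "pi / 4"] by (simp add: field_simps)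
      ultimately show ?thesis by (simp add: trig xy' cs 3)
    next
      case 4
      have "p = 8 * j + 7" using 4 by (simp add: j_def) presburger
      hence "p\<^sup>2 - 1 = 8 * (2 * (4 * j * j + 7 * j + 3))" by (simp add: power2_eq_square algebra_simps)
      hence "even ((p\<^sup>2 - 1) div 8)" by simp
      moreover have "cos (7 * pi / 4) = cos (pi / 4)"
        using cos_2pi_minus[of "pi / 4"] by (simp add: field_simps)
      ultimately show ?thesis by (simp add: trig xy' cs 4)
    qed
  qed
  \<comment> \<open>The extra factor x + y makes the exponent p + 1 even and both sides rational
    integers.\<close>
  have "cyclo_cong 8 p ((x + y) ^ p * (x + y)) ((x ^ p + y ^ p) * (x + y))"
    using xy by (intro cyclo_cong_mult_right cyclo_cong_frobenius cyclo_ints_add p) auto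
  also have "(x + y) ^ p * (x + y) = ((x + y)\<^sup>2) ^ (n + 1)"
    by (subst power_mult[symmetric]) (simp add: pn)
  also have "\<dots> = of_int 2 * of_int (2 ^ n)" by (simp add: sq)
  also have "(x ^ p + y ^ p) * (x + y) = of_int ((-1) ^ ((p\<^sup>2 - 1) div 8)) * (x + y)\<^sup>2"
    unfolding frob by (simp only: power2_eq_square mult.assoc)
  also have "\<dots> = of_int 2 * of_int ((-1) ^ ((p\<^sup>2 - 1) div 8))"
    by (simp add: sq)
  finally have C: "cyclo_cong 8 p (of_int 2 * of_int (2 ^ n)) (of_int 2 * of_int ((-1) ^ ((p\<^sup>2 - 1) div 8)))" .
  have "coprime 2 (int p)" using p(2) by (simp add: coprime_left_2_iff_odd)
  hence "cyclo_cong 8 p (of_int (2 ^ n)) (of_int ((-1) ^ ((p\<^sup>2 - 1) div 8)))"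
    using N by (intro cyclo_cong_cancel[OF N C] cyclo_ints_of_int)
  thus ?thesis unfolding n_def using prime_gt_0_nat[OF p(1)] by (rule cyclo_cong_of_intD[OF N])
qed

text \<open>Consecutive terms have ratios 2 (2m+1) / (m+1) and -4 (n-m) / (m+1), which agree modulo
  p because 2 n = -1 there; m + 1 is invertible since it is at most n < p.\<close>

lemma central_binomial_cong:
  fixes p m :: nat
  assumes p: "prime p" "odd p" and m: "m \<le> (p - 1) div 2"
  shows "[int ((2 * m) choose m) = (-4) ^ m * int (((p - 1) div 2) choose m)] (mod int p)"
  using m
proof (induction m)
  case (Suc m)
  define n where "n = (p - 1) div 2"
  have pn: "int p = 2 * int n + 1" using p(2) by (auto simp: n_def elim!: oddE)
  have mn: "m < n" using Suc.prems by (simp add: n_def)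
  have 1: "int (Suc m) * int ((2 * Suc m) choose Suc m) = 2 * (2 * int m + 1) * int ((2 * m) choose m)"
  proof -
    have "Suc m * ((2 * Suc m) choose Suc m) = Suc m * (Suc (Suc (2 * m)) choose Suc m)" by simp
    also have "\<dots> = Suc (Suc (2 * m)) * (Suc (2 * m) choose m)" by (rule Suc_times_binomial)
    also have "\<dots> = 2 * (Suc m * (Suc (2 * m) choose m))" by simp
    also have "Suc (2 * m) choose m = Suc (2 * m) choose Suc m"
      using binomial_symmetric[of m "Suc (2 * m)"] by (simp add: Suc_diff_le)
    also have "Suc m * \<dots> = Suc (2 * m) * ((2 * m) choose m)" by (rule Suc_times_binomial)
    also have "Suc (2 * m) = 2 * m + 1" by simp
    finally have "Suc m * ((2 * Suc m) choose Suc m) = 2 * ((2 * m + 1) * ((2 * m) choose m))" .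
    hence "int (Suc m * ((2 * Suc m) choose Suc m)) = int (2 * ((2 * m + 1) * ((2 * m) choose m)))" by (rule arg_cong)
    thus ?thesis by (simp only: of_nat_mult of_nat_add of_nat_numeral of_nat_1 mult.assoc)
  qed
  have 2: "int (Suc m) * int (n choose Suc m) = (int n - int m) * int (n choose m)"
  proof -
    have "Suc m * (n choose Suc m) = (n - m) * (n choose m)"
      by (simp only: binomial_absorption binomial_absorb_comp)
    hence "int (Suc m * (n choose Suc m)) = int ((n - m) * (n choose m))" by (rule arg_cong)
    thus ?thesis using mn by (simp only: of_nat_mult of_nat_diff less_imp_le)
  qed
  have "[2 * (2 * int m + 1) = - 4 * (int n - int m)] (mod int p)"
    unfolding cong_iff_dvd_diff by (rule dvdI[of _ _ 2]) (simp add: pn)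
  hence "[2 * (2 * int m + 1) * int ((2 * m) choose m) =
      - 4 * (int n - int m) * ((-4) ^ m * int (n choose m))] (mod int p)"
    by (rule cong_mult) (use Suc.IH mn in \<open>simp add: n_def\<close>)
  also have "- 4 * (int n - int m) * ((-4) ^ m * int (n choose m)) =
      (-4) ^ Suc m * ((int n - int m) * int (n choose m))"
    by (simp only: power_Suc mult_ac)
  also have "\<dots> = int (Suc m) * ((-4) ^ Suc m * int (n choose Suc m))" by (simp only: flip: 2) simp
  finally have "[int (Suc m) * int ((2 * Suc m) choose Suc m) =
      int (Suc m) * ((-4) ^ Suc m * int (n choose Suc m))] (mod int p)" unfolding 1 .
  moreover have "coprime (int (Suc m)) (int p)"
  proof -
    have "\<not> p dvd Suc m" using mn pn by (auto dest: dvd_imp_le)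
    hence "coprime p (Suc m)" using p(1) prime_imp_coprime by blast
    thus ?thesis by (metis coprime_commute coprime_int_iff)
  qed
  ultimately show ?case unfolding n_def by (simp only: cong_mult_lcancel)
qed simp

lemma sum_powers_pm:
  fixes x y :: complex
  shows "(x + y) ^ n + (x - y) ^ n = 2 * (\<Sum>k\<le>n div 2. of_nat (n choose (2 * k)) * y ^ (2 * k) * x ^ (n - 2 * k))"
proof -
  have "(x + y) ^ n + (x - y) ^ n = (y + x) ^ n + (- y + x) ^ n" by (simp add: add.commute)
  also have "\<dots> = (\<Sum>j\<le>n. of_nat (n choose j) * (y ^ j + (- y) ^ j) * x ^ (n - j))"
    unfolding binomial_ring by (simp add: sum.distrib algebra_simps)
  also have "\<dots> = (\<Sum>j\<in>(\<lambda>k. 2 * k) ` {..n div 2}. of_nat (n choose j) * (y ^ j + (- y) ^ j) * x ^ (n - j))"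
  proof (rule sum.mono_neutral_right)
    show "\<forall>j\<in>{..n} - (\<lambda>k. 2 * k) ` {..n div 2}. of_nat (n choose j) * (y ^ j + (- y) ^ j) * x ^ (n - j) = 0"
    proof
      fix j assume j: "j \<in> {..n} - (\<lambda>k. 2 * k) ` {..n div 2}"
      have "odd j"
      proof
        assume "even j"
        then obtain k where "j = 2 * k" by auto
        thus False using j by auto
      qed
      thus "of_nat (n choose j) * (y ^ j + (- y) ^ j) * x ^ (n - j) = 0" by simp
    qed
  qed auto
  also have "\<dots> = (\<Sum>k\<le>n div 2. of_nat (n choose (2 * k)) * (y ^ (2 * k) + (- y) ^ (2 * k)) * x ^ (n - 2 * k))"
    by (subst sum.reindex) (auto simp: inj_on_def)
  also have "\<dots> = 2 * (\<Sum>k\<le>n div 2. of_nat (n choose (2 * k)) * y ^ (2 * k) * x ^ (n - 2 * k))"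
    by (simp add: sum_distrib_left mult_ac)
  finally show ?thesis .
qed

section \<open>The quartic Gauss sums\<close>

context quartic_setup
begin

abbreviation "g \<equiv> gauss_sum q \<chi>"
abbreviation "h \<equiv> gauss_sum q (\<lambda>x. \<chi> x ^ 3)"
abbreviation "c \<equiv> gauss_sum q (\<lambda>x. (\<chi> x)\<^sup>2)"

lemma mult_char_quartic2: "mult_char q (\<lambda>x. (\<chi> x)\<^sup>2)"
  and mult_char_quartic3: "mult_char q (\<lambda>x. \<chi> x ^ 3)"
  using mult_char_power[OF mult_char_quartic] by auto

lemma sum_quartic_char_square: "(\<Sum>x\<in>{0..<int q}. (\<chi> x)\<^sup>2) = 0"
proof -
  obtain r where "\<not> int q dvd r" "(\<chi> r)\<^sup>2 = -1" by (rule exists_quartic_char_square)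
  thus ?thesis by (intro sum_mult_char_eq_0[OF q mult_char_quartic2]) auto
qed

lemma gauss_sum_quartic_square: "g\<^sup>2 = J * c"
  using gauss_sum_mult[OF q mult_char_quartic mult_char_quartic] sum_quartic_char_square
  by (simp add: power2_eq_square)

text \<open>The cube of the character is its conjugate, and its sixth power is its square.\<close>

lemma gauss_sum_quartic3_square: "h\<^sup>2 = cnj J * c"
proof -
  have "jacobi_sum q (\<lambda>x. \<chi> x ^ 3) (\<lambda>x. \<chi> x ^ 3) = cnj J"
    by (simp add: jacobi_sum_def cnj_sum cnj_quartic_char)
  moreover have "\<chi> x ^ 3 * \<chi> x ^ 3 = (\<chi> x)\<^sup>2" for x
    using quartic_char_power_mod4[of 6 2 x] by (simp add: cong_def flip: power_add)
  ultimately show ?thesis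
    using gauss_sum_mult[OF q mult_char_quartic3 mult_char_quartic3] sum_quartic_char_square
    by (simp add: power2_eq_square)
qed

lemma quartic_char_power3_minus_1: "\<chi> (-1) ^ 3 = (-1) ^ e"
  unfolding quartic_char_minus_1 by (cases "even e") auto

lemma gauss_sum_quartic_mult: "g * h = (-1) ^ e * of_nat q"
proof -
  obtain r where r: "\<not> int q dvd r" "(\<chi> r)\<^sup>2 = -1" by (rule exists_quartic_char_square)
  have "\<chi> r \<noteq> 1" using r(2) by auto
  moreover have "\<chi> x * \<chi> x ^ 3 = 1" if "\<not> int q dvd x" for x
    using quartic_char_power4[OF that] by (simp flip: power_Suc)
  ultimately show ?thesis
    using gauss_sum_mult_inverse[OF q mult_char_quartic mult_char_quartic3 _ r(1)]
    by (simp add: quartic_char_power3_minus_1)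
qed

lemma gauss_sum_quadratic_square: "c\<^sup>2 = of_nat q"
proof -
  obtain r where r: "\<not> int q dvd r" "(\<chi> r)\<^sup>2 = -1" by (rule exists_quartic_char_square)
  have "(\<chi> x)\<^sup>2 * (\<chi> x)\<^sup>2 = 1" if "\<not> int q dvd x" for x
    using quartic_char_power4[OF that] by (simp flip: power_add)
  hence "c * c = (\<chi> (-1))\<^sup>2 * of_nat q"
    using gauss_sum_mult_inverse[OF q mult_char_quartic2 mult_char_quartic2 _ r(1)] r(2) by simp
  thus ?thesis by (cases "even e") (simp_all add: power2_eq_square quartic_char_minus_1)
qed

text \<open>Compares two evaluations of (g h)^2: from the product g h, and from the two
  squares.\<close>

lemma jacobi_sum_norm: "J * cnj J = of_nat q"
proof -
  have "of_nat q * of_nat q = (g * h)\<^sup>2"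
    unfolding gauss_sum_quartic_mult by (simp add: power_mult_distrib power2_eq_square flip: power_add)
  also have "\<dots> = (J * cnj J) * c\<^sup>2"
    unfolding power_mult_distrib gauss_sum_quartic_square gauss_sum_quartic3_square
    by (simp add: power2_eq_square[of c])
  finally show ?thesis using q_ge_5 by (simp add: gauss_sum_quadratic_square)
qed

text \<open>J and a + b i have norm q and lie in the same prime ideal, so they differ by a unit;
  their odd real parts rule out i and -i.\<close>

lemma jacobi_sum_eq:
  fixes a b :: int
  assumes ab: "int q = a\<^sup>2 + b\<^sup>2" "odd a" and bm: "[b * m = - a] (mod int q)"
  obtains s :: int where "s\<^sup>2 = 1" "J = of_int s * (of_int a + of_int b * \<i>)"
proof -
  obtain A B where AB: "J = of_int A + of_int B * \<i>" "[A + B * m = 0] (mod int q)"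
    by (rule jacobi_sum_gauss_int)
  have odd: "odd A" using jacobi_sum_odd_real_part[OF AB(1)] .
  have "of_int (A\<^sup>2 + B\<^sup>2) = (of_int (int q) :: complex)"
    using jacobi_sum_norm unfolding AB(1) by (simp add: complex_eq_iff power2_eq_square)
  hence norm: "A\<^sup>2 + B\<^sup>2 = int q" by (simp only: of_int_eq_iff)
  have q0: "int q > 0" using q_ge_5 by simp
  have "even b" using ab q_eq by (metis even_add even_power even_mult_iff even_numeral odd_one of_nat_1 of_nat_add of_nat_mult of_nat_numeral pos2)
  \<comment> \<open>Eliminates m from the two conditions of lying in the ideal.\<close>
  have "[b * (A + B * m) + B * (- a - b * m) = b * 0 + B * 0] (mod int q)"
  proof (intro cong_add cong_mult cong_refl AB)
    have "[- a - b * m = - a - (- a)] (mod int q)" by (intro cong_diff cong_refl bm)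
    thus "[- a - b * m = 0] (mod int q)" by simp
  qed
  hence "int q dvd A * b - B * a" by (simp add: cong_0_iff algebra_simps)
  then obtain k where k: "A * b - B * a = int q * k" by auto
  have id: "(A * a + B * b)\<^sup>2 + (A * b - B * a)\<^sup>2 = (int q)\<^sup>2"
  proof -
    have "(A * a + B * b)\<^sup>2 + (A * b - B * a)\<^sup>2 = (A\<^sup>2 + B\<^sup>2) * (a\<^sup>2 + b\<^sup>2)"
      by (simp add: algebra_simps power2_eq_square)
    thus ?thesis using norm ab by (simp add: power2_eq_square)
  qed
  \<comment> \<open>Otherwise the second square in \<open>id\<close> exhausts q^2 and A a + B b = 0,
    impossible because A a is odd and b is even.\<close>
  have "k = 0"
  proof (rule ccontr)
    assume "k \<noteq> 0"
    hence "k\<^sup>2 \<ge> 1" by (metis int_one_le_iff_zero_less zero_less_power2)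
    hence "(A * b - B * a)\<^sup>2 \<ge> (int q)\<^sup>2"
      using mult_left_mono[of 1 "k\<^sup>2" "(int q)\<^sup>2"] by (simp add: k power_mult_distrib)
    hence "(A * a + B * b)\<^sup>2 \<le> 0" using id by linarith
    hence "A * a + B * b = 0" by simp
    hence "even (A * a)" using \<open>even b\<close> by (metis even_add even_mult_iff even_zero)
    thus False using odd ab(2) by simp
  qed
  hence det: "A * b = B * a" using k by simp
  hence "(A * a + B * b)\<^sup>2 = (int q)\<^sup>2" using id by simp
  hence "A * a + B * b = int q \<or> A * a + B * b = - int q" by (simp add: power2_eq_iff)
  then obtain s :: int where s: "s\<^sup>2 = 1" "A * a + B * b = s * int q"
    by (metis mult_1 mult_minus1 power_one power2_minus)
  have "int q * A = int q * (s * a)"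
  proof -
    have "int q * A = a * (A * a + B * b) - b * (B * a - A * b)"
      by (simp add: ab(1) algebra_simps power2_eq_square)
    thus ?thesis using s(2) det by (simp add: mult_ac)
  qed
  hence A: "A = s * a" using q0 by simp
  have "int q * B = int q * (s * b)"
  proof -
    have "int q * B = b * (A * a + B * b) + a * (B * a - A * b)"
      by (simp add: ab(1) algebra_simps power2_eq_square)
    thus ?thesis using s(2) det by (simp add: mult_ac)
  qed
  hence B: "B = s * b" using q0 by simp
  show ?thesis by (rule that[OF s(1)]) (simp add: AB(1) A B algebra_simps)
qed

end

section \<open>The main congruence\<close>

context quartic_setup
begin

text \<open>With c^2 = q and y^2 = a^2 this is c^n ((c + y)^n + (c - y)^n) / 2, an integer because
  only even powers of y survive.\<close>

definition even_sum :: "nat \<Rightarrow> int \<Rightarrow> int" where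
  "even_sum n a = (\<Sum>k\<le>n div 2. int (n choose (2 * k)) * a ^ (2 * k) * int q ^ (n - k))"

lemma gauss_sum_power_identity:
  fixes s a b :: int
  assumes s: "s\<^sup>2 = 1" and J: "J = of_int s * (of_int a + of_int b * \<i>)"
  shows "(g + h) ^ (2 * n) + (-1) ^ n * (g - h) ^ (2 * n) =
           of_int (2 * (2 ^ n * ((-1) ^ e) ^ n * even_sum n a))"
proof -
  define \<eta> :: complex where "\<eta> = (-1) ^ e"
  \<comment> \<open>Absorbs both unknown signs. Only y^2 = a^2 survives, so neither the sign of J
    nor that of a matters.\<close>
  define y where "y = \<eta> * of_int (s * a)"
  have \<eta>: "\<eta> * \<eta> = 1" by (simp add: \<eta>_def flip: power_add)
  have gh: "g * h = \<eta> * c\<^sup>2" by (simp add: gauss_sum_quartic_mult gauss_sum_quadratic_square \<eta>_def)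
  have sq: "g\<^sup>2 + h\<^sup>2 = 2 * of_int (s * a) * c"
    unfolding gauss_sum_quartic_square gauss_sum_quartic3_square J by (simp add: algebra_simps)
  have "(g + h)\<^sup>2 = 2 * of_int (s * a) * c + 2 * (\<eta> * c\<^sup>2)"
    using sq gh by (simp add: power2_sum mult.assoc)
  also have "\<dots> = 2 * \<eta> * c * c + 2 * (\<eta> * \<eta>) * of_int (s * a) * c"
    unfolding \<eta> by (simp add: power2_eq_square)
  also have "\<dots> = 2 * \<eta> * c * (c + y)" by (simp add: y_def algebra_simps)
  finally have plus: "(g + h)\<^sup>2 = 2 * \<eta> * c * (c + y)" .
  have "(g - h)\<^sup>2 = 2 * of_int (s * a) * c - 2 * (\<eta> * c\<^sup>2)"
    using sq gh by (simp add: power2_diff mult.assoc)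
  also have "\<dots> = 2 * (\<eta> * \<eta>) * of_int (s * a) * c - 2 * \<eta> * c * c"
    unfolding \<eta> by (simp add: power2_eq_square)
  also have "\<dots> = (-1) * (2 * \<eta> * c * (c - y))" by (simp add: y_def algebra_simps)
  finally have minus: "(g - h)\<^sup>2 = (-1) * (2 * \<eta> * c * (c - y))" .
  have y2: "y\<^sup>2 = of_int (a\<^sup>2)"
  proof -
    have "y\<^sup>2 = (\<eta> * \<eta>) * of_int (s\<^sup>2 * a\<^sup>2)" by (simp add: y_def power2_eq_square mult_ac)
    thus ?thesis by (simp add: \<eta> s)
  qed
  have "(g + h) ^ (2 * n) + (-1) ^ n * (g - h) ^ (2 * n) =
      (2 * \<eta> * c) ^ n * ((c + y) ^ n + ((-1) * (-1)) ^ n * (c - y) ^ n)"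
    unfolding power_mult plus minus power_mult_distrib by (simp add: algebra_simps)
  also have "\<dots> = 2 * (2 ^ n * \<eta> ^ n * (c ^ n * (\<Sum>k\<le>n div 2. of_nat (n choose (2 * k)) * y ^ (2 * k) * c ^ (n - 2 * k))))"
    by (simp add: sum_powers_pm power_mult_distrib mult_ac)
  also have "c ^ n * (\<Sum>k\<le>n div 2. of_nat (n choose (2 * k)) * y ^ (2 * k) * c ^ (n - 2 * k)) = of_int (even_sum n a)"
    unfolding even_sum_def sum_distrib_left of_int_sum
  proof (rule sum.cong)
    fix k assume "k \<in> {..n div 2}"
    hence "n + (n - 2 * k) = 2 * (n - k)" by auto
    hence "c ^ n * c ^ (n - 2 * k) = (c\<^sup>2) ^ (n - k)" by (simp flip: power_add power_mult)
    moreover have "y ^ (2 * k) = of_int (a ^ (2 * k))" by (simp add: power_mult y2)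
    ultimately have "c ^ n * c ^ (n - 2 * k) * y ^ (2 * k) = of_nat q ^ (n - k) * of_int (a ^ (2 * k))"
      by (simp add: gauss_sum_quadratic_square)
    thus "c ^ n * (of_nat (n choose (2 * k)) * y ^ (2 * k) * c ^ (n - 2 * k)) =
        of_int (int (n choose (2 * k)) * a ^ (2 * k) * int q ^ (n - k))"
      by (simp add: mult_ac)
  qed simp
  finally show ?thesis by (simp add: \<eta>_def)
qed

text \<open>A multiple of 4 and of q, so the ring contains the values of the quartic character and
  of the additive one.\<close>

abbreviation "N \<equiv> 8 * q"

lemma N_pos: "N > 0" using q_ge_5 by simp

lemma ii_cyclo_ints: "\<i> \<in> cyclo_ints N"
  using cyclo_ints_cis[OF N_pos, of 4 1] by (simp add: cis_pi_half)

lemma quartic_char_cyclo_ints: "\<chi> x \<in> cyclo_ints N"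
proof (cases "int q dvd x")
  case False
  then obtain k where "\<chi> x = \<i> ^ k" by (rule quartic_char_cases)
  thus ?thesis using cyclo_ints_power[OF N_pos ii_cyclo_ints] by simp
qed (simp add: quartic_char_dvd cyclo_ints_0[OF N_pos])

lemma gauss_sums_cyclo_ints: "g \<in> cyclo_ints N" "h \<in> cyclo_ints N" "c \<in> cyclo_ints N"
  by (intro gauss_sum_cyclo_ints[OF N_pos] cyclo_ints_power[OF N_pos] quartic_char_cyclo_ints; simp)+

lemma quartic_char_power_times:
  assumes "\<not> int q dvd x" "[j + k = 0] (mod 4)" "k > 0"
  shows "\<chi> x ^ j * \<chi> x ^ k = 1"
proof -
  have "\<chi> x ^ j * \<chi> x ^ k = \<chi> x ^ 4"
    using quartic_char_power_mod4[of "j + k" 4 x] assms by (simp add: cong_def power_add)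
  thus ?thesis using quartic_char_power4[OF assms(1)] by simp
qed

end

section \<open>Frobenius at p applied to the quartic Gauss sums\<close>

locale quartic_setup_prime = quartic_setup +
  fixes p :: nat and a b :: int
  assumes p: "prime p" "odd p" "p \<noteq> q" and pb: "\<not> int p dvd b"
    and ab: "int q = a\<^sup>2 + b\<^sup>2" "odd a" and bm: "[b * m = - a] (mod int q)"
begin

abbreviation "n \<equiv> (p - 1) div 2"
abbreviation "t \<equiv> \<chi> (int p)"

lemma p_eq: "p = 2 * n + 1"
  using p(2) by (auto elim!: oddE)

lemma p_pos: "p > 0" using p(1) prime_gt_0_nat by blast

lemma q_not_dvd_p: "\<not> int q dvd int p"
  using p(1,3) q primes_dvd_imp_eq by auto

lemma coprime_p: "coprime 2 (int p)" "coprime (int q) (int p)" "coprime b (int p)"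
proof -
  show "coprime 2 (int p)" using p(2) by (simp add: coprime_left_2_iff_odd)
  show "coprime (int q) (int p)" using p(1,3) q by (simp add: primes_coprime)
  have "prime (int p)" using p(1) by simp
  thus "coprime b (int p)" using pb prime_imp_coprime coprime_commute by blast
qed

text \<open>One statement for g, h and c and both classes of p modulo 4. The power
  \<open>t ^ l\<close> is the inverse of \<open>t ^ k\<close>.\<close>

lemma frobenius_quartic:
  assumes "j > 0" "k > 0" "[j * p = k] (mod 4)" "[l + k = 0] (mod 4)"
  shows "cyclo_cong N p (gauss_sum q (\<lambda>x. \<chi> x ^ j) ^ p) (t ^ l * gauss_sum q (\<lambda>x. \<chi> x ^ k))"
proof -
  have R: "t ^ i \<in> cyclo_ints N" for i
    by (intro cyclo_ints_power[OF N_pos] quartic_char_cyclo_ints)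
  have jk: "(\<chi> x ^ j) ^ p = \<chi> x ^ k" for x
    using quartic_char_power_mod4[OF assms(3)] assms p_pos by (simp flip: power_mult)
  have "cyclo_cong N p ((t ^ j) ^ p * gauss_sum q (\<lambda>x. \<chi> x ^ j) ^ p) (gauss_sum q (\<lambda>x. (\<chi> x ^ j) ^ p))"
    by (intro gauss_sum_frobenius[OF N_pos] cyclo_ints_power[OF N_pos] quartic_char_cyclo_ints q p
         mult_char_power mult_char_quartic assms) simp
  hence "cyclo_cong N p (t ^ l * (t ^ k * gauss_sum q (\<lambda>x. \<chi> x ^ j) ^ p)) (t ^ l * gauss_sum q (\<lambda>x. \<chi> x ^ k))"
    unfolding jk using R by (rule cyclo_cong_mult_left[OF N_pos])
  moreover have "t ^ l * t ^ k = 1"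
    using q_not_dvd_p assms by (intro quartic_char_power_times)
  ultimately show ?thesis by (simp flip: mult.assoc)
qed

text \<open>Crossing each p-th power with the opposite factor prepares the extraction of (g + h) (g
  - h). For p = 3 modulo 4 Frobenius exchanges g and h, and the sign \<open>(-1) ^ n\<close>
  compensates for that.\<close>

lemma frobenius_combination:
  "cyclo_cong N p ((g + h) ^ p * (g - h) + (-1) ^ n * ((g - h) ^ p * (g + h))) (2 * (t ^ 3 * g\<^sup>2 - t * h\<^sup>2))"
proof -
  note R = gauss_sums_cyclo_ints
  have P: "cyclo_cong N p ((g + h) ^ p) (g ^ p + h ^ p)"
    by (intro cyclo_cong_frobenius[OF N_pos] p R)
  have "cyclo_cong N p ((g + - h) ^ p) (g ^ p + (- h) ^ p)"
    by (intro cyclo_cong_frobenius[OF N_pos] p R cyclo_ints_uminus[OF N_pos])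
  hence M: "cyclo_cong N p ((g - h) ^ p) (g ^ p - h ^ p)" using p(2) by simp
  have "p mod 4 = 1 \<or> p mod 4 = 3" using p(2) by presburger
  thus ?thesis
  proof
    assume p4: "p mod 4 = 1"
    hence "even n" by presburger
    have G: "cyclo_cong N p (g ^ p) (t ^ 3 * g)"
      using frobenius_quartic[of 1 1 3] p4 by (simp add: cong_def)
    have "3 * p mod 4 = 3" using p4 by presburger
    hence H: "cyclo_cong N p (h ^ p) (t * h)"
      using frobenius_quartic[of 3 3 1] by (simp add: cong_def)
    have "cyclo_cong N p ((g + h) ^ p * (g - h) + (g - h) ^ p * (g + h))
        ((t ^ 3 * g + t * h) * (g - h) + (t ^ 3 * g - t * h) * (g + h))"
      using R
      by (intro cyclo_cong_add[OF N_pos] cyclo_cong_mult_right[OF N_pos] cyclo_ints_add[OF N_pos]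
            cyclo_ints_diff[OF N_pos] cyclo_cong_trans[OF N_pos P cyclo_cong_add[OF N_pos G H]]
            cyclo_cong_trans[OF N_pos M cyclo_cong_diff[OF N_pos G H]])
    thus ?thesis using \<open>even n\<close> by (simp add: algebra_simps power2_eq_square)
  next
    assume p4: "p mod 4 = 3"
    hence "odd n" by presburger
    have G: "cyclo_cong N p (g ^ p) (t * h)"
      using frobenius_quartic[of 1 3 1] p4 by (simp add: cong_def)
    have "3 * p mod 4 = 1" using p4 by presburger
    hence H: "cyclo_cong N p (h ^ p) (t ^ 3 * g)"
      using frobenius_quartic[of 3 1 3] by (simp add: cong_def)
    have "cyclo_cong N p ((g + h) ^ p * (g - h) - (g - h) ^ p * (g + h))
        ((t * h + t ^ 3 * g) * (g - h) - (t * h - t ^ 3 * g) * (g + h))"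
      using R
      by (intro cyclo_cong_diff[OF N_pos] cyclo_cong_mult_right[OF N_pos] cyclo_ints_add[OF N_pos]
            cyclo_ints_diff[OF N_pos] cyclo_cong_trans[OF N_pos P cyclo_cong_add[OF N_pos G H]]
            cyclo_cong_trans[OF N_pos M cyclo_cong_diff[OF N_pos G H]])
    thus ?thesis using \<open>odd n\<close> by (simp add: algebra_simps power2_eq_square)
  qed
qed

text \<open>Half of the combination in \<open>gauss_sum_power_identity\<close>. Modulo p its first
  two factors become the sign in front of the sum.\<close>

definition W :: int where
  "W = 2 ^ n * ((-1) ^ e) ^ n * even_sum n a"

lemma W_cong: 
  "cyclo_cong N p (of_int (2 * b * W) * \<i>)
     (t ^ 3 * (of_int a + of_int b * \<i>) - t * (of_int a - of_int b * \<i>))"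
proof -
  obtain s :: int where s: "s\<^sup>2 = 1" and J: "J = of_int s * (of_int a + of_int b * \<i>)"
    using jacobi_sum_eq[OF ab bm] .
  have diff: "(g + h) * (g - h) = of_int (2 * b * s) * \<i> * c"
  proof -
    have "(g + h) * (g - h) = g\<^sup>2 - h\<^sup>2" by (simp add: algebra_simps power2_eq_square)
    thus ?thesis
      unfolding gauss_sum_quartic_square gauss_sum_quartic3_square J by (simp add: algebra_simps)
  qed
  have "(g + h) ^ p * (g - h) + (-1) ^ n * ((g - h) ^ p * (g + h)) =
      ((g + h) ^ (2 * n) + (-1) ^ n * (g - h) ^ (2 * n)) * ((g + h) * (g - h))"
    by (subst (1 2) p_eq) (simp add: algebra_simps)
  also have "\<dots> = of_int (2 * W) * (of_int (2 * b * s) * \<i> * c)"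
    unfolding diff by (simp only: gauss_sum_power_identity[OF s J] W_def)
  finally have "cyclo_cong N p (of_int (2 * W) * (of_int (2 * b * s) * \<i> * c)) (2 * (t ^ 3 * g\<^sup>2 - t * h\<^sup>2))"
    using frobenius_combination by simp
  \<comment> \<open>Both sides contain s c as a factor; multiplying by it once more gives s^2 c^2 =
    q, which can be cancelled.\<close>
  hence "cyclo_cong N p (of_int (2 * W) * (of_int (2 * b * s) * \<i> * c) * (of_int s * c))
     (2 * (t ^ 3 * g\<^sup>2 - t * h\<^sup>2) * (of_int s * c))"
    by (intro cyclo_cong_mult_right[OF N_pos] cyclo_ints_mult[OF N_pos] gauss_sums_cyclo_ints cyclo_ints_of_int[OF N_pos])
  also have "of_int (2 * W) * (of_int (2 * b * s) * \<i> * c) * (of_int s * c) =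
      of_int (2 * (2 * b * W) * s\<^sup>2) * \<i> * c\<^sup>2"
    by (simp add: power2_eq_square mult_ac)
  also have "\<dots> = of_int (2 * int q) * (of_int (2 * b * W) * \<i>)"
    by (simp add: s gauss_sum_quadratic_square mult_ac)
  also have "2 * (t ^ 3 * g\<^sup>2 - t * h\<^sup>2) * (of_int s * c) =
      2 * of_int (s\<^sup>2) * c\<^sup>2 * (t ^ 3 * (of_int a + of_int b * \<i>) - t * (of_int a - of_int b * \<i>))"
    unfolding gauss_sum_quartic_square gauss_sum_quartic3_square J
    by (simp add: algebra_simps power2_eq_square)
  also have "\<dots> = of_int (2 * int q) * (t ^ 3 * (of_int a + of_int b * \<i>) - t * (of_int a - of_int b * \<i>))"
    by (simp add: s gauss_sum_quadratic_square)
  finally show ?thesis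
  proof (rule cyclo_cong_cancel[OF N_pos])
    show "coprime (2 * int q) (int p)" using coprime_p by simp
    show "of_int (2 * b * W) * \<i> \<in> cyclo_ints N"
      by (intro cyclo_ints_mult[OF N_pos] ii_cyclo_ints cyclo_ints_of_int[OF N_pos])
    show "t ^ 3 * (of_int a + of_int b * \<i>) - t * (of_int a - of_int b * \<i>) \<in> cyclo_ints N"
      by (intro cyclo_ints_mult[OF N_pos] cyclo_ints_diff[OF N_pos] cyclo_ints_add[OF N_pos]
           ii_cyclo_ints cyclo_ints_of_int[OF N_pos] cyclo_ints_power[OF N_pos] quartic_char_cyclo_ints)
  qed
qed

text \<open>Quadratic reciprocity for p and q by the classical route: Frobenius on the quadratic
  Gauss sum c, whose square is q.\<close>

lemma q_power_cong:
  assumes "t\<^sup>2 = of_int r"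
  shows "[int q ^ n = r] (mod int p)"
proof -
  have "[2 * p = 2] (mod 4)" using p(2) by (simp add: cong_def) presburger
  hence "cyclo_cong N p (c ^ p) (t\<^sup>2 * c)"
    using frobenius_quartic[of 2 2 2] by (simp add: cong_def)
  hence "cyclo_cong N p (c ^ p * c) (t\<^sup>2 * c * c)"
    by (intro cyclo_cong_mult_right[OF N_pos] gauss_sums_cyclo_ints)
  also have "c ^ p * c = (c\<^sup>2) ^ (n + 1)"
    by (subst power_mult[symmetric], subst p_eq) (simp add: mult_ac)
  also have "\<dots> = of_int (int q * int q ^ n)" by (simp add: gauss_sum_quadratic_square)
  also have "t\<^sup>2 * c * c = t\<^sup>2 * c\<^sup>2" by (simp only: power2_eq_square mult.assoc)
  also have "\<dots> = of_int (int q * r)" by (simp add: gauss_sum_quadratic_square assms)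
  finally have "[int q * int q ^ n = int q * r] (mod int p)"
    using p_pos by (rule cyclo_cong_of_intD[OF N_pos])
  thus ?thesis using coprime_p(2) by (simp add: cong_mult_lcancel)
qed

text \<open>For real t the terms with a cancel in \<open>W_cong\<close> and 2 b t i remains;
  multiplying by i makes both sides integers.\<close>

lemma W_cong_real:
  assumes "\<tau> \<in> {1, -1}" "[int p ^ e = \<tau>] (mod int q)"
  shows "[W = \<tau>] (mod int p)" "[int q ^ n = 1] (mod int p)"
proof -
  have t: "t = of_int \<tau>"
  proof (cases "\<tau> = 1")
    case True
    thus ?thesis using quartic_char_eq[OF q_not_dvd_p, of 0] assms by simp
  next
    case False
    hence \<tau>: "\<tau> = -1" using assms(1) by simp
    hence "[int p ^ e = m ^ 2] (mod int q)" using assms(2) m cong_sym cong_trans by blast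
    thus ?thesis using quartic_char_eq[OF q_not_dvd_p, of 2] \<tau> by simp
  qed
  have t3: "t ^ 3 = of_int \<tau>" and t2: "t\<^sup>2 = of_int 1" using assms(1) by (auto simp: t)
  show "[int q ^ n = 1] (mod int p)" by (rule q_power_cong[OF t2])
  have "cyclo_cong N p (of_int (2 * b * W) * \<i> * \<i>) (of_int (2 * b * \<tau>) * \<i> * \<i>)"
    using cyclo_cong_mult_right[OF N_pos W_cong ii_cyclo_ints]
    unfolding t3 unfolding t by (simp add: algebra_simps)
  hence "cyclo_cong N p (of_int (- (2 * b * W))) (of_int (- (2 * b * \<tau>)))" by (simp add: mult.assoc)
  hence "[- (2 * b * W) = - (2 * b * \<tau>)] (mod int p)"
    using p_pos by (rule cyclo_cong_of_intD[OF N_pos])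
  hence "[2 * b * W = 2 * b * \<tau>] (mod int p)" by (simp only: cong_minus_minus_iff)
  moreover have "coprime (2 * b) (int p)" using coprime_p by simp
  ultimately show "[W = \<tau>] (mod int p)" by (simp only: cong_mult_lcancel)
qed

text \<open>For t = \<open>\<tau>\<close> i the terms with b cancel instead, leaving -2
  \<open>\<tau>\<close> a i. The factor b on the left survives and becomes the denominator of
  a/b.\<close>

lemma W_cong_imaginary:
  assumes "\<tau> \<in> {1, -1}" "[int p ^ e = \<tau> * m] (mod int q)"
  shows "[b * W = - (\<tau> * a)] (mod int p)" "[int q ^ n = -1] (mod int p)"
proof -
  have t: "t = of_int \<tau> * \<i>"
  proof (cases "\<tau> = 1")
    case True
    thus ?thesis using quartic_char_eq[OF q_not_dvd_p, of 1] assms by simp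
  next
    case False
    hence \<tau>: "\<tau> = -1" using assms(1) by simp
    have "[m * m ^ 2 = m * (-1)] (mod int q)" by (intro cong_mult cong_refl m)
    hence "[m ^ 3 = \<tau> * m] (mod int q)" by (simp add: \<tau> power3_eq_cube power2_eq_square mult.assoc)
    hence "[int p ^ e = m ^ 3] (mod int q)" using assms(2) cong_sym cong_trans by blast
    thus ?thesis using quartic_char_eq[OF q_not_dvd_p, of 3] \<tau> by (simp add: power3_eq_cube)
  qed
  have t3: "t ^ 3 = - of_int \<tau> * \<i>" and t2: "t\<^sup>2 = of_int (-1)"
    using assms(1) by (auto simp: t power_mult_distrib power3_eq_cube)
  show "[int q ^ n = -1] (mod int p)" by (rule q_power_cong[OF t2])
  have "cyclo_cong N p (of_int (2 * b * W) * \<i> * \<i>) (- of_int (2 * (\<tau> * a)) * \<i> * \<i>)"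
    using cyclo_cong_mult_right[OF N_pos W_cong ii_cyclo_ints]
    unfolding t3 unfolding t by (simp add: algebra_simps)
  hence "cyclo_cong N p (of_int (- (2 * (b * W)))) (of_int (- (2 * (- (\<tau> * a)))))" by (simp add: mult_ac)
  hence "[- (2 * (b * W)) = - (2 * (- (\<tau> * a)))] (mod int p)"
    using p_pos by (rule cyclo_cong_of_intD[OF N_pos])
  hence "[2 * (b * W) = 2 * (- (\<tau> * a))] (mod int p)" by (simp only: cong_minus_minus_iff)
  thus "[b * W = - (\<tau> * a)] (mod int p)" using coprime_p(1) by (simp only: cong_mult_lcancel)
qed

end

section \<open>Rational congruences\<close>

text \<open>\<open>rat_cong\<close> speaks of the reduced denominator; this allows any convenient
  denominator in its place.\<close>

lemma snd_quotient_of_dvd: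
  assumes "r = of_int u / of_int d" "d \<noteq> 0"
  shows "snd (quotient_of r) dvd d"
proof -
  obtain x y where xy: "quotient_of r = (x, y)" by (cases "quotient_of r")
  have r: "r = of_int x / of_int y" using quotient_of_div[OF xy] .
  have y: "y > 0" using quotient_of_denom_pos[OF xy] .
  have "(of_int (x * d) :: rat) = of_int (u * y)"
    using r assms y by (simp add: field_simps)
  hence "y dvd d * x" by (simp only: of_int_eq_iff) (simp add: mult.commute)
  hence "y dvd d" using quotient_of_coprime[OF xy] by (simp add: coprime_commute coprime_dvd_mult_left_iff)
  thus ?thesis by (simp add: xy)
qed

lemma rat_congI:
  assumes "of_int d * (x - y) = of_int (m * u)" "coprime d m" "d \<noteq> 0"
  shows "rat_cong x y m"
  unfolding rat_cong_def
proof (intro exI conjI)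
  show "x - y = of_int m * (of_int u / of_int d)" using assms(1,3) by (simp add: field_simps)
  show "coprime (snd (quotient_of (of_int u / of_int d))) m"
    using snd_quotient_of_dvd[OF refl assms(3)] assms(2) coprime_divisors dvd_refl by blast
qed

lemma rat_cong_fractionD:
  assumes "rat_cong (of_int x) (of_int y / of_int z) m" "z \<noteq> 0"
  shows "[z * x = y] (mod m)"
proof -
  obtain r where r: "of_int x - of_int y / of_int z = of_int m * r" "coprime (snd (quotient_of r)) m"
    using assms(1) unfolding rat_cong_def by blast
  obtain u d where ud: "quotient_of r = (u, d)" by (cases "quotient_of r")
  have rud: "r = of_int u / of_int d" using quotient_of_div[OF ud] .
  have d: "d > 0" using quotient_of_denom_pos[OF ud] .
  have "(of_int (d * (z * x - y)) :: rat) = of_int (m * (z * u))"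
    using r(1) d assms(2) unfolding rud by (simp add: field_simps)
  hence "m dvd d * (z * x - y)" by (simp only: of_int_eq_iff) simp
  moreover have "coprime m d" using r(2) ud by (simp add: coprime_commute)
  ultimately show ?thesis by (simp add: cong_iff_dvd_diff coprime_dvd_mult_right_iff)
qed

text \<open>If q divided b, it would divide a as well, and q^2 would divide q.\<close>

lemma coprime_sum_two_squares:
  fixes a b :: int and q :: nat
  assumes q: "prime q" and ab: "int q = a\<^sup>2 + b\<^sup>2"
  shows "coprime b (int q)"
proof -
  have prime_q: "prime (int q)" using q by simp
  have "\<not> int q dvd b"
  proof
    assume qb: "int q dvd b"
    have "a\<^sup>2 = int q - b * b" using ab by (simp add: power2_eq_square)
    hence "int q dvd a\<^sup>2" using qb by simp
    hence "int q dvd a" using prime_q prime_dvd_power by blast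
    hence "int q * int q dvd a\<^sup>2 + b\<^sup>2" 
      using qb unfolding power2_eq_square by (intro dvd_add mult_dvd_mono)
    hence "int q * int q dvd int q * 1" using ab by simp
    thus False using prime_gt_1_nat[OF q] by (subst (asm) dvd_mult_cancel_left) auto
  qed
  thus ?thesis using prime_q prime_imp_coprime coprime_commute by blast
qed

context quartic_setup_prime
begin

definition coeff_sum :: rat where
  "coeff_sum = (\<Sum>k = 0..p div 4. of_nat ((4*k) choose (2*k)) * (of_int (a\<^sup>2) / (16 * of_nat q)) ^ k)"

text \<open>The rational form of q^n S = \<open>even_sum n a\<close> modulo p, with S the sum of the
  theorem: (16 q)^(p div 4) is a common denominator, and the powers of 16 cancel against those in
  the binomial congruence.\<close>

lemma coeff_sum_clear_denominators:
  obtains u where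
    "of_int ((16 * int q) ^ (p div 4)) * (of_nat q ^ n * coeff_sum - of_int (even_sum n a)) = of_int (int p * u)"
proof -
  define M where "M = p div 4"
  obtain j where "p = 2 * j + 1" using p(2) by (rule oddE)
  \<comment> \<open>Aligns the ranges of both sums and gives 2 k <= n, as
    \<open>central_binomial_cong\<close> demands.\<close>
  hence M: "M = n div 2" by (simp add: M_def div_mult2_eq[of _ 2 2, simplified])
  have "\<exists>z. int ((4*k) choose (2*k)) = 16 ^ k * int (n choose (2*k)) + int p * z" if "k \<le> M" for k
  proof -
    have "2 * k \<le> n" using that M by simp
    hence "[int ((2 * (2*k)) choose (2*k)) = (-4) ^ (2*k) * int (n choose (2*k))] (mod int p)"
      using central_binomial_cong[OF p(1,2)] by blast
    hence "int p dvd int ((4*k) choose (2*k)) - 16 ^ k * int (n choose (2*k))"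
      by (simp add: cong_iff_dvd_diff power_mult)
    then obtain z where "int ((4*k) choose (2*k)) - 16 ^ k * int (n choose (2*k)) = int p * z" by (rule dvdE)
    thus ?thesis by (intro exI[of _ z]) simp
  qed
  then obtain z where z: "\<And>k. k \<le> M \<Longrightarrow> int ((4*k) choose (2*k)) = 16 ^ k * int (n choose (2*k)) + int p * z k"
    by metis
  \<comment> \<open>Collects the multiples of p that arise when the binomials are replaced one by
    one.\<close>
  define u where "u = (\<Sum>k\<le>M. (16 * int q) ^ (M - k) * int q ^ n * a ^ (2*k) * z k)"
  let ?D = "of_int ((16 * int q) ^ M) :: rat"
  have q0: "(of_nat q :: rat) \<noteq> 0" using q_ge_5 by simp
  have "?D * (of_nat q ^ n * coeff_sum - of_int (even_sum n a)) =
     (\<Sum>k\<le>M. ?D * (of_nat q ^ n * (of_int (int ((4*k) choose (2*k))) * (of_int (a\<^sup>2) / (16 * of_nat q)) ^ k)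
         - of_int (int (n choose (2 * k)) * a ^ (2 * k) * int q ^ (n - k))))"
    unfolding coeff_sum_def even_sum_def M_def[symmetric] M[symmetric] atLeast0AtMost
    by (simp only: of_int_sum sum_distrib_left sum_subtractf right_diff_distrib of_int_of_nat_eq)
  also have "\<dots> = (\<Sum>k\<le>M. of_int (int p * ((16 * int q) ^ (M - k) * int q ^ n * a ^ (2*k) * z k)))"
  proof (rule sum.cong)
    fix k assume "k \<in> {..M}"
    hence k: "k \<le> M" by simp
    have kn: "k \<le> n" using k M by simp
    have D: "?D = (16 * of_nat q) ^ (M - k) * (16 * of_nat q) ^ k"
    proof -
      have "?D = (16 * of_nat q) ^ (M - k + k)" using k by simp
      thus ?thesis by (simp only: power_add)
    qed
    have qn: "(of_nat q :: rat) ^ n = of_nat q ^ (n - k) * of_nat q ^ k" using kn by (simp flip: power_add)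
    have A: "(16 * of_nat q) ^ k * (of_int (a\<^sup>2) / (16 * of_nat q)) ^ k = (of_int (a ^ (2*k)) :: rat)"
    proof -
      have "(16 * of_nat q) ^ k * (of_int (a\<^sup>2) / (16 * of_nat q)) ^ k =
          ((16 * of_nat q) * (of_int (a\<^sup>2) / (16 * of_nat q)) :: rat) ^ k"
        by (rule power_mult_distrib[symmetric])
      also have "(16 * of_nat q) * (of_int (a\<^sup>2) / (16 * of_nat q)) = (of_int (a\<^sup>2) :: rat)"
        using q0 by simp
      finally show ?thesis by (simp add: power_mult)
    qed
    let ?C = "of_int (int ((4*k) choose (2*k))) :: rat"
    let ?B = "of_int (int (n choose (2*k))) :: rat"
    have C: "?C = 16 ^ k * ?B + of_nat p * of_int (z k)"
      unfolding z[OF k] by simp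
    have "?D * (of_nat q ^ n * (?C * (of_int (a\<^sup>2) / (16 * of_nat q)) ^ k)) =
       (16 * of_nat q) ^ (M - k) * of_nat q ^ n * ?C * ((16 * of_nat q) ^ k * (of_int (a\<^sup>2) / (16 * of_nat q)) ^ k)"
      unfolding D by (simp only: mult_ac)
    also have "\<dots> = (16 * of_nat q) ^ (M - k) * of_nat q ^ n * (16 ^ k * ?B) * of_int (a ^ (2*k)) +
        of_nat p * ((16 * of_nat q) ^ (M - k) * of_nat q ^ n * of_int (a ^ (2*k)) * of_int (z k))"
      unfolding A C by (simp only: distrib_left distrib_right mult_ac)
    also have "(16 * of_nat q) ^ (M - k) * of_nat q ^ n * (16 ^ k * ?B) * of_int (a ^ (2*k)) =
        ?D * (?B * of_int (a ^ (2*k)) * of_nat q ^ (n - k))"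
      unfolding D qn by (simp only: power_mult_distrib mult_ac)
    finally show "?D * (of_nat q ^ n * (?C * (of_int (a\<^sup>2) / (16 * of_nat q)) ^ k)
         - of_int (int (n choose (2 * k)) * a ^ (2 * k) * int q ^ (n - k))) =
        of_int (int p * ((16 * int q) ^ (M - k) * int q ^ n * a ^ (2*k) * z k))"
      by (simp add: right_diff_distrib)
  qed simp
  also have "\<dots> = of_int (int p * u)" by (simp only: u_def sum_distrib_left of_int_sum)
  finally show ?thesis using that unfolding M_def by blast
qed

text \<open>The signed sum is W / q^n modulo p, so the premise says that this quotient is x / y. All
  denominators used are products of 2, q and y, hence prime to p.\<close>

lemma rat_cong_coeff_sum:
  fixes x y :: int
  assumes cong: "[y * W = int q ^ n * x] (mod int p)" and y: "coprime y (int p)" "y \<noteq> 0"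
  shows "rat_cong ((-1) ^ ((p\<^sup>2 - 1) div 8 + n * e) * coeff_sum) (of_int x / of_int y) (int p)"
proof -
  define \<epsilon> :: int where "\<epsilon> = (-1) ^ ((p\<^sup>2 - 1) div 8 + n * e)"
  let ?D = "(16 * int q) ^ (p div 4)"
  obtain u where u: "of_int ?D * (of_nat q ^ n * coeff_sum - of_int (even_sum n a)) = (of_int (int p * u) :: rat)"
    by (rule coeff_sum_clear_denominators)
  have "[W = \<epsilon> * even_sum n a] (mod int p)"
  proof -
    have "[2 ^ n * ((-1) ^ e) ^ n * even_sum n a = (-1) ^ ((p\<^sup>2 - 1) div 8) * ((-1) ^ e) ^ n * even_sum n a] (mod int p)"
      by (intro cong_mult cong_refl two_power_half_cong p)
    also have "(-1) ^ ((p\<^sup>2 - 1) div 8) * ((-1) ^ e) ^ n = \<epsilon>"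
      unfolding \<epsilon>_def power_add power_mult[symmetric] by (simp only: mult.commute)
    finally show ?thesis unfolding W_def .
  qed
  hence "[y * W = y * (\<epsilon> * even_sum n a)] (mod int p)" by (intro cong_mult cong_refl)
  hence "[y * (\<epsilon> * even_sum n a) = int q ^ n * x] (mod int p)" using cong cong_sym cong_trans by blast
  then obtain v where v: "y * (\<epsilon> * even_sum n a) - int q ^ n * x = int p * v"
    unfolding cong_iff_dvd_diff by (rule dvdE)
  show ?thesis
  proof (rule rat_congI)
    let ?x = "of_int x / of_int y :: rat"
    have "of_int (?D * int q ^ n * y) * (of_int \<epsilon> * coeff_sum - ?x) =
       of_int (y * \<epsilon>) * (of_int ?D * (of_nat q ^ n * coeff_sum)) - of_int ?D * of_nat q ^ n * (of_int y * ?x)"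
      by (simp add: algebra_simps)
    also have "of_int y * ?x = of_int x" using y(2) by simp
    also have "of_int ?D * (of_nat q ^ n * coeff_sum) = (of_int ?D * of_int (even_sum n a) + of_int (int p * u) :: rat)"
      using u by (simp add: algebra_simps)
    also have "(of_int (y * \<epsilon>) :: rat) * (of_int ?D * of_int (even_sum n a) + of_int (int p * u)) - of_int ?D * of_nat q ^ n * of_int x =
        of_int (?D * (y * (\<epsilon> * even_sum n a) - int q ^ n * x) + y * \<epsilon> * int p * u)"
      by (simp add: algebra_simps)
    also have "\<dots> = (of_int (int p * (?D * v + y * \<epsilon> * u)) :: rat)"
      unfolding v by (simp add: algebra_simps)
    finally show "of_int (?D * int q ^ n * y) * ((-1) ^ ((p\<^sup>2 - 1) div 8 + n * e) * coeff_sum - ?x) =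
        of_int (int p * (?D * v + y * \<epsilon> * u))"
      by (simp add: \<epsilon>_def)
    have "coprime (2 ^ 4) (int p)" using coprime_p(1) by (simp only: coprime_power_left_iff) simp
    hence "coprime 16 (int p)" by simp
    thus "coprime (?D * int q ^ n * y) (int p)"
      using coprime_p y(1) by simp
    show "?D * int q ^ n * y \<noteq> 0" using y(2) q_ge_5 by simp
  qed
qed

lemma rat_cong_coeff_sum_real:
  assumes "\<tau> \<in> {1, -1}" "rat_cong (of_nat p ^ e) (of_int \<tau>) (int q)"
  shows "rat_cong ((-1) ^ ((p\<^sup>2 - 1) div 8 + n * e) * coeff_sum) (of_int \<tau>) (int p)"
proof -
  have "rat_cong (of_int (int p ^ e)) (of_int \<tau> / of_int 1) (int q)" using assms(2) by simp
  hence "[1 * int p ^ e = \<tau>] (mod int q)" by (rule rat_cong_fractionD) simp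
  hence W: "[W = \<tau>] (mod int p)" "[int q ^ n = 1] (mod int p)"
    using W_cong_real[OF assms(1)] by simp_all
  have "[int q ^ n * \<tau> = 1 * \<tau>] (mod int p)" by (intro cong_mult cong_refl W)
  hence "[1 * W = int q ^ n * \<tau>] (mod int p)" using W(1) cong_sym cong_trans by fastforce
  from rat_cong_coeff_sum[OF this] show ?thesis by simp
qed

text \<open>As a/b is -m modulo q, the character value is -\<open>\<tau>\<close> i, which gives b W
  = \<open>\<tau>\<close> a; dividing by q^n = -1 reverses the sign.\<close>

lemma rat_cong_coeff_sum_imaginary:
  assumes "\<tau> \<in> {1, -1}" "rat_cong (of_nat p ^ e) (of_int (\<tau> * a) / of_int b) (int q)"
  shows "rat_cong ((-1) ^ ((p\<^sup>2 - 1) div 8 + n * e) * coeff_sum) (of_int (- \<tau> * a) / of_int b) (int p)"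
proof -
  have b0: "b \<noteq> 0" using pb by auto
  have "rat_cong (of_int (int p ^ e)) (of_int (\<tau> * a) / of_int b) (int q)" using assms(2) by simp
  hence "[b * int p ^ e = \<tau> * a] (mod int q)" using b0 by (rule rat_cong_fractionD)
  also have "[\<tau> * a = \<tau> * - (b * m)] (mod int q)"
  proof (rule cong_mult[OF cong_refl])
    have "[- (b * m) = - (- a)] (mod int q)" using bm by (simp only: cong_minus_minus_iff)
    thus "[a = - (b * m)] (mod int q)" by (simp add: cong_sym_eq)
  qed
  also have "\<tau> * - (b * m) = b * (- \<tau> * m)" by simp
  finally have "[b * int p ^ e = b * (- \<tau> * m)] (mod int q)" .
  moreover have "coprime b (int q)" using q ab(1) by (rule coprime_sum_two_squares)
  ultimately have P: "[int p ^ e = - \<tau> * m] (mod int q)" by (simp only: cong_mult_lcancel)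
  have \<tau>': "- \<tau> \<in> {1, -1}" using assms(1) by auto
  note W = W_cong_imaginary[OF \<tau>' P]
  have "[int q ^ n * (- \<tau> * a) = (-1) * (- \<tau> * a)] (mod int p)" by (intro cong_mult cong_refl W)
  hence "[b * W = int q ^ n * (- \<tau> * a)] (mod int p)" using W(1) cong_sym cong_trans by fastforce
  from rat_cong_coeff_sum[OF this coprime_p(3) b0] show ?thesis .
qed

end

theorem theorem2p2:
  fixes p q :: nat and a b :: int
  assumes "prime q" and "[q = 1] (mod 4)"
    and "int q = a\<^sup>2 + b\<^sup>2" and "odd a"
    and "prime p" and "odd p" and "\<not> int p dvd b * int q"
  defines "S \<equiv> (\<Sum>k = 0..p div 4. of_nat ((4*k) choose (2*k)) * (of_int (a\<^sup>2) / (16 * of_nat q)) ^ k :: rat)"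
    and "\<sigma> \<equiv> ((-1::rat) ^ ((p\<^sup>2 - 1) div 8 + ((p - 1) div 2) * ((q - 1) div 4)))"
    and "e \<equiv> (q - 1) div 4"
  shows "(rat_cong (of_nat p ^ e) 1 (int q) \<longrightarrow> rat_cong (\<sigma> * S) 1 (int p))
       \<and> (rat_cong (of_nat p ^ e) (-1) (int q) \<longrightarrow> rat_cong (\<sigma> * S) (-1) (int p))
       \<and> (rat_cong (of_nat p ^ e) (of_int a / of_int b) (int q) \<longrightarrow> rat_cong (\<sigma> * S) (- (of_int a / of_int b)) (int p))
       \<and> (rat_cong (of_nat p ^ e) (- (of_int a / of_int b)) (int q) \<longrightarrow> rat_cong (\<sigma> * S) (of_int a / of_int b) (int p))"
proof -
  have q_eq: "q = 4 * e + 1"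
  proof -
    have "q mod 4 = 1" using assms(2) by (simp add: cong_def)
    thus ?thesis unfolding e_def by presburger
  qed
  have cop: "coprime b (int q)" using assms(1,3) by (rule coprime_sum_two_squares)
  then obtain b' where b': "[b * b' = 1] (mod int q)" using cong_solve_coprime_int by blast
  \<comment> \<open>This is -a/b modulo q, the square root of -1 for which a + b i reduces to
    0.\<close>
  define m where "m = b' * - a"
  have "[b * b' * - a = 1 * - a] (mod int q)" by (intro cong_mult cong_refl b')
  hence bm: "[b * m = - a] (mod int q)" by (simp add: m_def mult.assoc)
  have m2: "[m\<^sup>2 = -1] (mod int q)"
  proof -
    have "[b\<^sup>2 * m\<^sup>2 = a\<^sup>2] (mod int q)" using cong_pow[OF bm, of 2] by (simp add: power_mult_distrib)
    moreover have "[a\<^sup>2 = b\<^sup>2 * (-1)] (mod int q)" using assms(3) by (simp add: cong_iff_dvd_diff)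
    ultimately have "[b\<^sup>2 * m\<^sup>2 = b\<^sup>2 * (-1)] (mod int q)" by (rule cong_trans)
    moreover have "coprime (b\<^sup>2) (int q)" using cop by simp
    ultimately show ?thesis by (simp only: cong_mult_lcancel)
  qed
  have pqb: "p \<noteq> q" "\<not> int p dvd b" using assms(7) by auto
  interpret quartic_setup_prime q e m p a b
    by unfold_locales (fact assms q_eq m2 bm pqb)+
  have \<sigma>: "\<sigma> = (-1) ^ ((p\<^sup>2 - 1) div 8 + n * e)" by (simp add: \<sigma>_def e_def)
  have S: "S = coeff_sum" by (simp add: S_def coeff_sum_def)
  show ?thesis
    using rat_cong_coeff_sum_real[of 1] rat_cong_coeff_sum_real[of "-1"]
      rat_cong_coeff_sum_imaginary[of 1] rat_cong_coeff_sum_imaginary[of "-1"]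
    unfolding \<sigma> S by simp
qed

end
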